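(* Let $\mathcal{X},\mathcal{Y}$ be real Hilbert spaces, $b\in\mathcal{Y}$, $A:\mathcal{X}\to\mathcal{Y}$ a bounded linear operator and $f:\mathcal{X}\to\mathbb{R}$ a convex and continuously differentiable function. Let $t_0>0$, $r\in[0,1]$, $\alpha,\theta>0$ be such that - if $r\in[0,1)$, then $\frac{2}{\alpha}<\theta$; - if $r=1$, then $\frac{2}{\alpha+1}\le\theta<\frac12$. Let $\beta:[t_0,+\infty)\to(0,+\infty)$ be continuously differentiable and nondecreasing with $$\sup_{t\ge t_0} t^{r}\left(\frac{\dot\beta(t)}{\beta(t)}+\frac{2r}{t}\right)<\frac1\theta .$$ Let $(x_*,\lambda_* )\in\mathcal{X}\times\mathcal{Y}$ be a primal-dual solution of the problem of minimizing $f(x)$ subject to $Ax=b$, and let $t\mapsto(x(t),\lambda(t))$ be a solution on $[t_0,+\infty)$ to $$\begin{cases}\ddot x(t)+\frac{\alpha}{t^{r}}\dot x(t)+\theta t^{r}\beta(t)\frac{d}{dt}\nabla f(x(t))+\beta(t)A^{*}\bigl(\lambda(t)+\theta t^{r}\dot\lambda(t)\bigr)+\beta(t)\nabla f(x(t))=0,\\[2pt] \ddot\lambda(t)+\frac{\alpha}{t^{r}}\dot\lambda(t)-\beta(t)\bigl[A\bigl(x(t)+\theta t^{r}\dot x(t)\bigr)-b\bigr]=0.\end{cases}$$ For $\rho\ge0$ consider the following convergence rates as $t\to+\infty$: $$\mathcal{L}(x(t),\lambda_* )-\mathcal{L}(x_*,\lambda(t))=o\left(\frac{1}{t^{2\rho}\beta(t)}\right),\quad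 |f(x(t))-f(x_* )|=o\left(\frac{1}{t^{2\rho}\beta(t)}\right),$$ $$\|Ax(t)-b\|=o\left(\frac{1}{t^{\rho+r}\beta(t)}\right),\quad \|\dot x(t)\|=o\left(\frac1{t^{\rho}}\right),\quad \|\dot\lambda(t)\|=o\left(\frac{1}{t^{\rho}}\right),$$ and, additionally, if $\nabla f$ is $L$-Lipschitz continuous for some $L>0$, the rates $$\|\nabla f(x(t))-\nabla f(x_* )\|=o\left(\frac{1}{t^{\rho}\sqrt{\beta(t)}}\right),\quad \|A^{*}(\lambda(t)-\lambda_* )\|=o\left(\frac{1}{t^{\rho}\sqrt{\beta(t)}}\right).$$ Denote by $(R_\rho)$ the collection of all these rates (the last two being included only when $\nabla f$ is Lipschitz continuous). Then: (i) If $r\in(0,1)$, then $(R_\rho)$ holds for every $\rho\in(0,r)$. Furthermore, if $t\mapsto(x(t),\lambda(t))$ is bounded, then $(R_\rho)$ holds for $\rho=r$. (ii) If $r=0$ or $r=1$, then $t\mapsto(x(t),\lambda(t))$ is bounded; moreover, $(R_\rho)$ holds with $\rho=0$ (if $r=0$) and with $\rho=1$ (if $r=1$). (iii) If $r=0$, or $r=1$, or ($r\in(0,1)$ and $t\mapsto(x(t),\lambda(t))$ is bounded), then $(x(t),\lambda(t))$ converges weakly to a primal-dual solution of the problem as $t\to+\infty$.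
   Context: The Lagrangian is $\mathcal{L}(x,\lambda)=f(x)+\langle\lambda,Ax-b\rangle$ on $\mathcal{X}\times\mathcal{Y}$. A primal-dual solution of $\min\{f(x): Ax=b\}$ is a pair $(x_*,\lambda_* )$ with $\nabla f(x_* )+A^{*}\lambda_*=0$ and $Ax_*=b$ (equivalently, a saddle point of $\mathcal{L}$), where $A^*$ is the adjoint of $A$. Dots denote derivatives with respect to $t$. For positive $g$, $h(t)=o(g(t))$ as $t\to+\infty$ means $h(t)/g(t)\to0$. A solution of the system is understood in the classical sense: $x,\lambda$ are twice differentiable, $t\mapsto\nabla f(x(t))$ is differentiable, and the equations hold for every $t\ge t_0$. *)

theory Defs
  imports "HOL-Analysis.Analysis" "HOL-Library.Landau_Symbols"
begin

text \<open>
  Real Hilbert spaces are types of sort \<open>{real_inner, complete_space}\<close>. The library constant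
  \<^const>\<open>adjoint\<close> is a choice operator; for a bounded linear operator between Hilbert spaces the map
  it selects exists (Riesz representation) and is unique. The gradient of \<open>f\<close> is passed as a
  function \<open>Df\<close>, which in the theorem is pinned down by \<^const>\<open>gderiv\<close>.
\<close>

definition lagrangian ::
  "('a::real_inner \<Rightarrow> real) \<Rightarrow> ('a \<Rightarrow> 'b::real_inner) \<Rightarrow> 'b \<Rightarrow> 'a \<Rightarrow> 'b \<Rightarrow> real" where
  "lagrangian f A b x lam = f x + lam \<bullet> (A x - b)"

definition primal_dual_solution ::
  "('a::real_inner \<Rightarrow> 'a) \<Rightarrow> ('a \<Rightarrow> 'b::real_inner) \<Rightarrow> 'b \<Rightarrow> 'a \<Rightarrow> 'b \<Rightarrow> bool" where
  "primal_dual_solution Df A b x lam \<longleftrightarrow> Df x + adjoint A lam = 0 \<and> A x = b"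

definition weakly_tendsto :: "('c \<Rightarrow> 'v::real_normed_vector) \<Rightarrow> 'v \<Rightarrow> 'c filter \<Rightarrow> bool" where
  "weakly_tendsto u l F \<longleftrightarrow>
     (\<forall>\<phi> :: 'v \<Rightarrow> real. bounded_linear \<phi> \<longrightarrow> ((\<lambda>t. \<phi> (u t)) \<longlongrightarrow> \<phi> l) F)"

text \<open>
  Classical solutions on \<open>[t\<^sub>0, \<infinity>)\<close>: \<open>x'\<close>, \<open>x''\<close>, \<open>lam'\<close>, \<open>lam''\<close> are the first and second derivatives
  of \<open>x\<close> and \<open>lam\<close>, and \<open>G'\<close> is the derivative of \<open>t \<mapsto> Df (x t)\<close>. All derivatives are taken within
  \<open>{t\<^sub>0..}\<close>, hence are one-sided at \<open>t\<^sub>0\<close>.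
\<close>

definition primal_dual_trajectory ::
  "('a::real_inner \<Rightarrow> 'a) \<Rightarrow> ('a \<Rightarrow> 'b::real_inner) \<Rightarrow> 'b \<Rightarrow>
   real \<Rightarrow> real \<Rightarrow> real \<Rightarrow> real \<Rightarrow> (real \<Rightarrow> real) \<Rightarrow>
   (real \<Rightarrow> 'a) \<Rightarrow> (real \<Rightarrow> 'a) \<Rightarrow> (real \<Rightarrow> 'a) \<Rightarrow> (real \<Rightarrow> 'a) \<Rightarrow>
   (real \<Rightarrow> 'b) \<Rightarrow> (real \<Rightarrow> 'b) \<Rightarrow> (real \<Rightarrow> 'b) \<Rightarrow> bool" where
  "primal_dual_trajectory Df A b t\<^sub>0 r \<alpha> \<theta> \<beta> x x' x'' G' lam lam' lam'' \<longleftrightarrow>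
     (\<forall>t\<ge>t\<^sub>0.
        (x has_vector_derivative x' t) (at t within {t\<^sub>0..}) \<and>
        (x' has_vector_derivative x'' t) (at t within {t\<^sub>0..}) \<and>
        ((\<lambda>s. Df (x s)) has_vector_derivative G' t) (at t within {t\<^sub>0..}) \<and>
        (lam has_vector_derivative lam' t) (at t within {t\<^sub>0..}) \<and>
        (lam' has_vector_derivative lam'' t) (at t within {t\<^sub>0..}) \<and>
        x'' t + (\<alpha> / t powr r) *\<^sub>R x' t + (\<theta> * t powr r * \<beta> t) *\<^sub>R G' t
          + \<beta> t *\<^sub>R adjoint A (lam t + (\<theta> * t powr r) *\<^sub>R lam' t) + \<beta> t *\<^sub>R Df (x t) = 0 \<and>
        lam'' t + (\<alpha> / t powr r) *\<^sub>R lam' t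
          - \<beta> t *\<^sub>R (A (x t + (\<theta> * t powr r) *\<^sub>R x' t) - b) = 0)"

definition convergence_rates ::
  "('a::real_inner \<Rightarrow> real) \<Rightarrow> ('a \<Rightarrow> 'a) \<Rightarrow> ('a \<Rightarrow> 'b::real_inner) \<Rightarrow> 'b \<Rightarrow>
   real \<Rightarrow> (real \<Rightarrow> real) \<Rightarrow>
   (real \<Rightarrow> 'a) \<Rightarrow> (real \<Rightarrow> 'a) \<Rightarrow> (real \<Rightarrow> 'b) \<Rightarrow> (real \<Rightarrow> 'b) \<Rightarrow>
   'a \<Rightarrow> 'b \<Rightarrow> real \<Rightarrow> bool" where
  "convergence_rates f Df A b r \<beta> x x' lam lam' xs lams \<rho> \<longleftrightarrow>
     (\<lambda>t. lagrangian f A b (x t) lams - lagrangian f A b xs (lam t))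
        \<in> o[at_top](\<lambda>t. 1 / (t powr (2 * \<rho>) * \<beta> t)) \<and>
     (\<lambda>t. \<bar>f (x t) - f xs\<bar>) \<in> o[at_top](\<lambda>t. 1 / (t powr (2 * \<rho>) * \<beta> t)) \<and>
     (\<lambda>t. norm (A (x t) - b)) \<in> o[at_top](\<lambda>t. 1 / (t powr (\<rho> + r) * \<beta> t)) \<and>
     (\<lambda>t. norm (x' t)) \<in> o[at_top](\<lambda>t. 1 / t powr \<rho>) \<and>
     (\<lambda>t. norm (lam' t)) \<in> o[at_top](\<lambda>t. 1 / t powr \<rho>) \<and>
     ((\<exists>L>0. L-lipschitz_on UNIV Df) \<longrightarrow>
        (\<lambda>t. norm (Df (x t) - Df xs)) \<in> o[at_top](\<lambda>t. 1 / (t powr \<rho> * sqrt (\<beta> t))) \<and>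
        (\<lambda>t. norm (adjoint A (lam t - lams))) \<in> o[at_top](\<lambda>t. 1 / (t powr \<rho> * sqrt (\<beta> t))))"

end

theory Submission
  imports Defs
begin

text \<open>
  Put \<open>z = (x, \<lambda>)\<close> and \<open>KKT (x, \<lambda>) = (\<nabla>f x + A\<^sup>* \<lambda>, b - A x)\<close>, a monotone operator whose zeros are the
  primal-dual solutions. The system is the single equation
  \<open>z'' + \<alpha> / t\<^sup>r z' + \<theta> t\<^sup>r \<beta> (d/dt) KKT z + \<beta> KKT z = 0\<close>. For a zero \<open>zs\<close> the energy
  \<open>1/2 |(z - zs) / \<theta> + t\<^sup>r z'|\<^sup>2 + t\<^sup>2\<^sup>r \<beta> (z - zs) \<bullet> KKT z + \<kappa> / (2 \<theta>) |z - zs|\<^sup>2\<close>, with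
  \<open>\<kappa> = \<alpha> - 1 / \<theta> - (d/dt) t\<^sup>r\<close>, has no cross terms in its derivative, since the factor \<open>1 / \<theta>\<close> turns
  \<open>(z - zs) \<bullet> (d/dt) KKT z\<close> and \<open>z' \<bullet> KKT z\<close> into the derivative of \<open>(z - zs) \<bullet> KKT z\<close>. Divided by
  \<open>\<kappa>\<close> it is nonincreasing, at rate at least \<open>t\<^sup>r |z'|\<^sup>2\<close>; hence \<open>z\<close> is bounded for every \<open>r\<close> in \<open>[0, 1]\<close>
  and \<open>t\<^sup>r |z'|\<^sup>2\<close> is integrable. In the time scale \<open>dt / t\<^sup>r\<close> both \<open>t\<^sup>r z' + \<theta> t\<^sup>2\<^sup>r \<beta> KKT z\<close>
  and \<open>t\<^sup>r z'\<close> obey exponentially damped equations with square integrable forcing, so both tend to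
  zero strongly. Therefore \<open>t\<^sup>2\<^sup>r \<beta> KKT z\<close> and \<open>t\<^sup>2\<^sup>r \<beta> (z - zs) \<bullet> KKT z\<close> tend to zero and \<open>|z - zs|\<close>
  converges. All the rates with \<open>\<rho> = r\<close> follow, and Opial's lemma gives weak convergence.
\<close>

section \<open>Riesz representation and adjoints\<close>

text \<open>The quadratic takes the value \<open>- d\<^sup>2 / q\<close> at
  \<open>s = - d / q\<close>, which is nonnegative only if \<open>d = 0\<close>. This is the
  first-order condition at a minimiser, used for Riesz representation.\<close>

lemma linear_le_quadratic_imp_zero:
  fixes d q :: real
  assumes nonneg: "\<And>s. 0 \<le> 2 * s * d + s\<^sup>2 * q"
  shows "d = 0"
proof (cases "q = 0")
  case True
  show ?thesis using nonneg[of 1] nonneg[of "-1"] True by simp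
next
  case False
  have "0 \<le> 2 * (- d / q) * d + (- d / q)\<^sup>2 * q" by (rule nonneg)
  also have "\<dots> = - (d\<^sup>2 / q)" using False by (simp add: field_simps power2_eq_square)
  finally have le: "d\<^sup>2 / q \<le> 0" by simp
  have "0 \<le> q" using nonneg[of 1] nonneg[of "-1"] by simp
  with False have "q > 0" by simp
  with le have "d\<^sup>2 \<le> 0" by (simp add: divide_le_0_iff)
  then show ?thesis by simp
qed

text \<open>The representing vector is the minimiser of the quadratic functional \<open>J\<close>: a
  minimising sequence is Cauchy by the parallelogram law, and the vanishing first variation at its
  limit is the required identity.\<close>

lemma riesz_representation:
  fixes \<phi> :: "'a::{real_inner, complete_space} \<Rightarrow> real"
  assumes "bounded_linear \<phi>"
  obtains w where "\<And>x. \<phi> x = x \<bullet> w"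
proof -
  interpret bounded_linear \<phi> by fact
  define J where "J v = v \<bullet> v - 2 * \<phi> v" for v
  obtain K where K: "\<And>v. norm (\<phi> v) \<le> norm v * K" using bounded by blast
  have lower: "- (K\<^sup>2) \<le> J v" for v
  proof -
    have "2 * \<phi> v \<le> 2 * (norm v * K)" using K[of v] by simp
    moreover have "0 \<le> (norm v - K)\<^sup>2" by simp
    ultimately show ?thesis
      by (simp add: J_def power2_diff dot_square_norm)
  qed
  define m where "m = Inf (range J)"
  have bdd: "bdd_below (range J)" using lower by (intro bdd_belowI[of _ "- (K\<^sup>2)"]) auto
  have m_le: "m \<le> J v" for v unfolding m_def using bdd by (intro cInf_lower) auto
  have "\<exists>v. J v < m + inverse (real (Suc n))" for n
  proof (rule ccontr)
    assume "\<nexists>v. J v < m + inverse (real (Suc n))"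
    then have "m + inverse (real (Suc n)) \<le> m"
      unfolding m_def by (intro cInf_greatest) (auto simp: not_less)
    moreover have "0 < inverse (real (Suc n))" by simp
    ultimately show False by linarith
  qed
  then obtain w where w: "\<And>n. J (w n) < m + inverse (real (Suc n))" by metis
  \<comment> \<open>Parallelogram law, with the infimum \<open>m\<close> as lower bound for
    \<open>J\<close> at the midpoint; the linear parts cancel.\<close>
  have par: "(norm (u - v))\<^sup>2 \<le> 2 * (J u - m) + 2 * (J v - m)" for u v
  proof -
    have "m \<le> J ((1/2) *\<^sub>R (u + v))" by (rule m_le)
    moreover have "J ((1/2) *\<^sub>R (u + v)) = ((u + v) \<bullet> (u + v)) / 4 - (\<phi> u + \<phi> v)"
      by (simp add: J_def scale add inner_add_left inner_add_right) (simp add: field_simps)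
    moreover have "(norm (u - v))\<^sup>2 = 2 * (u \<bullet> u) + 2 * (v \<bullet> v) - (u + v) \<bullet> (u + v)"
      by (simp add: power2_norm_eq_inner inner_diff_left inner_diff_right
          inner_add_left inner_add_right inner_commute)
    ultimately show ?thesis by (simp add: J_def)
  qed
  have "Cauchy w"
  proof (rule metric_CauchyI)
    fix e :: real assume "e > 0"
    then have "e\<^sup>2 / 4 > 0" by simp
    then obtain N where N: "inverse (real (Suc N)) < e\<^sup>2 / 4" using reals_Archimedean by blast
    have small: "J (w n) - m < e\<^sup>2 / 4" if "n \<ge> N" for n
    proof -
      have "inverse (real (Suc n)) \<le> inverse (real (Suc N))"
        using that by (intro le_imp_inverse_le) auto
      then show ?thesis using w[of n] N by linarith
    qed
    show "\<exists>M. \<forall>i\<ge>M. \<forall>j\<ge>M. dist (w i) (w j) < e"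
    proof (intro exI allI impI)
      fix i j assume "i \<ge> N" "j \<ge> N"
      then have "(norm (w i - w j))\<^sup>2 < e\<^sup>2"
        using par[of "w i" "w j"] small[OF \<open>i \<ge> N\<close>] small[OF \<open>j \<ge> N\<close>] by (simp add: field_simps)
      then have "norm (w i - w j) < e" using \<open>e > 0\<close> by (simp add: power_less_imp_less_base)
      then show "dist (w i) (w j) < e" by (simp add: dist_norm)
    qed
  qed
  then obtain u where u: "w \<longlonglongrightarrow> u" using Cauchy_convergent convergent_def by blast
  have "(\<lambda>n. J (w n)) \<longlonglongrightarrow> J u"
    unfolding J_def by (intro tendsto_intros tendsto u)
  moreover have "(\<lambda>n. m + inverse (real (Suc n))) \<longlonglongrightarrow> m + 0"
    by (intro tendsto_intros LIMSEQ_inverse_real_of_nat)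
  ultimately have Ju: "J u \<le> m"
    using w by (intro LIMSEQ_le[of _ "J u" _ m]) (auto intro: less_imp_le)
  have "\<phi> x = x \<bullet> u" for x
  proof -
    have "x \<bullet> u - \<phi> x = 0"
    proof (rule linear_le_quadratic_imp_zero)
      fix s :: real
      \<comment> \<open>The difference of the two sides is exactly the quadratic polynomial in
        \<open>s\<close> displayed next.\<close>
      have "J u \<le> J (u + s *\<^sub>R x)" using Ju m_le order_trans by blast
      then show "0 \<le> 2 * s * (x \<bullet> u - \<phi> x) + s\<^sup>2 * (x \<bullet> x)"
        by (simp add: J_def add scale inner_add_left inner_add_right inner_commute
            algebra_simps power2_eq_square)
    qed
    then show ?thesis by simp
  qed
  then show ?thesis by (rule that)
qed

text \<open>\<open>adjoint\<close> is a choice, so its defining property is available only once some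
  map satisfies it; Riesz representation of \<open>\<lambda>x. A x \<bullet> y\<close> for each
  \<open>y\<close> supplies one.\<close>

lemma adjoint_inner:
  fixes A :: "'a::{real_inner, complete_space} \<Rightarrow> 'b::real_inner"
  assumes "bounded_linear A"
  shows "A x \<bullet> y = x \<bullet> adjoint A y"
proof -
  have "\<exists>w. \<forall>x. A x \<bullet> y = x \<bullet> w" for y
  proof -
    have "bounded_linear (\<lambda>x. A x \<bullet> y)"
      using bounded_linear_compose[OF bounded_linear_inner_left assms] .
    then obtain w where "\<And>x. A x \<bullet> y = x \<bullet> w" using riesz_representation by blast
    then show ?thesis by blast
  qed
  then obtain B where "\<forall>x y. A x \<bullet> y = x \<bullet> B y" by metis
  then have "\<forall>x y. A x \<bullet> y = x \<bullet> adjoint A y" unfolding adjoint_def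
    by (rule someI[where P = "\<lambda>B. \<forall>x y. A x \<bullet> y = x \<bullet> B y"])
  then show ?thesis by blast
qed

text \<open>Linearity follows by testing against all vectors. The bound follows from
  \<open>norm (adjoint A y)\<close> squared being \<open>A (adjoint A y) \<bullet> y\<close>,
  divided by the norm when that is nonzero.\<close>

lemma bounded_linear_adjoint:
  fixes A :: "'a::{real_inner, complete_space} \<Rightarrow> 'b::real_inner"
  assumes A: "bounded_linear A"
  shows "bounded_linear (adjoint A)"
proof -
  obtain K where K: "\<And>x. norm (A x) \<le> norm x * K" and "K > 0"
    using bounded_linear.pos_bounded[OF A] by blast
  show ?thesis
  proof (rule bounded_linear_intro)
    show "adjoint A (x + y) = adjoint A x + adjoint A y" for x y
      by (rule vector_eq_ldot[THEN iffD1])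
         (simp add: inner_add_right adjoint_inner[OF A, symmetric])
    show "adjoint A (s *\<^sub>R x) = s *\<^sub>R adjoint A x" for s x
      by (rule vector_eq_ldot[THEN iffD1])
         (simp add: adjoint_inner[OF A, symmetric])
    show "norm (adjoint A y) \<le> norm y * K" for y
    proof (cases "adjoint A y = 0")
      case True then show ?thesis using \<open>K > 0\<close> by simp
    next
      case False
      have "norm (adjoint A y) * norm (adjoint A y) = A (adjoint A y) \<bullet> y"
        by (simp add: adjoint_inner[OF A] norm_eq_sqrt_inner)
      also have "\<dots> \<le> norm (A (adjoint A y)) * norm y" by (rule norm_cauchy_schwarz)
      also have "\<dots> \<le> norm (adjoint A y) * K * norm y" by (intro mult_right_mono K) auto
      also have "\<dots> = norm (adjoint A y) * (norm y * K)" by simp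
      finally show ?thesis using False by (simp only: mult_le_cancel_left_pos zero_less_norm_iff not_False_eq_True)
    qed
  qed
qed

section \<open>Gradients of convex functions and monotone curves\<close>

text \<open>Convexity bounds the difference quotients along the segment from \<open>x\<close> to
  \<open>y\<close> by \<open>f y - f x\<close> for \<open>0 < s < 1\<close>; the directional
  derivative is their limit from the right.\<close>

lemma convex_gradient_inequality:
  fixes f :: "'a::real_inner \<Rightarrow> real"
  assumes conv: "convex_on UNIV f" and grad: "GDERIV f x :> D"
  shows "f x + D \<bullet> (y - x) \<le> f y"
proof -
  have "((\<lambda>s. x + s *\<^sub>R (y - x)) has_derivative (\<lambda>s. s *\<^sub>R (y - x))) (at (0::real))"
    by (auto intro!: derivative_eq_intros)
  moreover have "(f has_derivative (\<lambda>h. h \<bullet> D)) (at (x + 0 *\<^sub>R (y - x)))"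
    using grad by (simp add: gderiv_def)
  ultimately have "((\<lambda>s. f (x + s *\<^sub>R (y - x))) has_derivative (\<lambda>s. (s *\<^sub>R (y - x)) \<bullet> D)) (at (0::real))"
    by (rule has_derivative_compose)
  moreover have "(\<lambda>s. (s *\<^sub>R (y - x)) \<bullet> D) = (*) ((y - x) \<bullet> D)" by (rule ext) simp
  ultimately have "((\<lambda>s. f (x + s *\<^sub>R (y - x))) has_real_derivative (y - x) \<bullet> D) (at 0)"
    by (simp only: has_field_derivative_def)
  then have "((\<lambda>s. (f (x + s *\<^sub>R (y - x)) - f x) / s) \<longlongrightarrow> (y - x) \<bullet> D) (at 0)"
    by (simp add: has_field_derivative_iff)
  then have lim: "((\<lambda>s. (f (x + s *\<^sub>R (y - x)) - f x) / s) \<longlongrightarrow> (y - x) \<bullet> D) (at_right 0)"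
    by (rule filterlim_mono) (auto simp: at_within_le_at)
  have "\<forall>\<^sub>F s in at_right 0. (f (x + s *\<^sub>R (y - x)) - f x) / s \<le> f y - f x"
  proof -
    have "\<forall>\<^sub>F s :: real in at_right 0. s \<in> {0<..<1}"
      by (rule eventually_at_right_real) simp
    then show ?thesis
    proof eventually_elim
      case (elim s)
      have "f ((1 - s) *\<^sub>R x + s *\<^sub>R y) \<le> (1 - s) * f x + s * f y"
        using elim by (intro convex_onD[OF conv]) auto
      moreover have "(1 - s) *\<^sub>R x + s *\<^sub>R y = x + s *\<^sub>R (y - x)" by (simp add: algebra_simps)
      ultimately show ?case using elim by (simp add: field_simps)
    qed
  qed
  then have "(y - x) \<bullet> D \<le> f y - f x"
    using tendsto_upperbound[OF lim] by simp
  then show ?thesis by (simp add: inner_commute)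
qed

lemma convex_gradient_monotone:
  fixes f :: "'a::real_inner \<Rightarrow> real"
  assumes "convex_on UNIV f" and "\<And>y. GDERIV f y :> Df y"
  shows "0 \<le> (Df x - Df y) \<bullet> (x - y)"
  using convex_gradient_inequality[OF assms, of x y] convex_gradient_inequality[OF assms, of y x]
  by (simp add: inner_diff_left inner_diff_right)

text \<open>Compares \<open>y\<close> with the gradient step of length \<open>1 / (2 * L)\<close> for the convex function
  \<open>f - Df x \<bullet> _\<close>, which is minimal at \<open>x\<close>; no integration along segments is needed.\<close>
lemma lipschitz_gradient_bound:
  fixes f :: "'a::real_inner \<Rightarrow> real"
  assumes conv: "convex_on UNIV f" and grad: "\<And>y. GDERIV f y :> Df y"
    and "L > 0" and lip: "L-lipschitz_on UNIV Df"
  shows "(norm (Df y - Df x))\<^sup>2 \<le> 4 * L * (f y - f x - Df x \<bullet> (y - x))"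
proof -
  define d where "d = Df y - Df x"
  define s where "s = 1 / (2 * L)"
  define u where "u = y - s *\<^sub>R d"
  have "s > 0" using \<open>L > 0\<close> by (simp add: s_def)
  have "norm (Df y - Df u) \<le> L * norm (y - u)"
    using lipschitz_onD[OF lip, of y u] by (simp add: dist_norm)
  also have "\<dots> = norm d / 2" using \<open>L > 0\<close> by (simp add: u_def s_def)
  finally have *: "norm (Df y - Df u) \<le> norm d / 2" .
  have "(Df y - Df u) \<bullet> d \<le> norm (Df y - Df u) * norm d" by (rule norm_cauchy_schwarz)
  also have "\<dots> \<le> norm d / 2 * norm d" by (intro mult_right_mono *) auto
  finally have "(Df y - Df u) \<bullet> d \<le> (norm d)\<^sup>2 / 2" by (simp add: power2_eq_square)
  moreover have "(Df u - Df x) \<bullet> d = d \<bullet> d - (Df y - Df u) \<bullet> d"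
    by (simp add: d_def inner_diff_left)
  ultimately have "(norm d)\<^sup>2 / 2 \<le> (Df u - Df x) \<bullet> d"
    by (simp add: power2_norm_eq_inner)
  then have "s * ((norm d)\<^sup>2 / 2) \<le> s * ((Df u - Df x) \<bullet> d)"
    using \<open>s > 0\<close> by (intro mult_left_mono) auto
  \<comment> \<open>Linearisation at \<open>x\<close> bounds \<open>f u\<close> from below and
    linearisation at \<open>u\<close> bounds \<open>f y\<close>; adding them leaves the extra gain
    \<open>s * ((Df u - Df x) \<bullet> d)\<close>.\<close>
  moreover have "f x + Df x \<bullet> (u - x) \<le> f u" "f u + Df u \<bullet> (y - u) \<le> f y"
    by (rule convex_gradient_inequality[OF conv grad])+
  moreover have "y - u = s *\<^sub>R d" "u - x = (y - x) - s *\<^sub>R d" by (simp_all add: u_def)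
  ultimately have "s * ((norm d)\<^sup>2 / 2) \<le> f y - f x - Df x \<bullet> (y - x)"
    by (simp add: inner_diff_left inner_diff_right right_diff_distrib)
  then show ?thesis using \<open>L > 0\<close> by (simp add: s_def d_def field_simps)
qed

lemma has_vector_derivative_imp_tendsto_quotient:
  assumes "(u has_vector_derivative u') (at t within X)"
  shows "((\<lambda>s. (u s - u t) /\<^sub>R (s - t)) \<longlongrightarrow> u') (at t within X)"
proof -
  have "((\<lambda>s. norm (u s - u t - (s - t) *\<^sub>R u') / norm (s - t)) \<longlongrightarrow> 0) (at t within X)"
    using assms by (simp add: has_vector_derivative_def has_derivative_iff_norm)
  moreover have "\<forall>\<^sub>F s in at t within X.
      norm (u s - u t - (s - t) *\<^sub>R u') / norm (s - t) = norm ((u s - u t) /\<^sub>R (s - t) - u')"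
    unfolding eventually_at_filter
  proof (rule always_eventually, intro allI impI)
    fix s assume "s \<noteq> t"
    then have "(u s - u t) /\<^sub>R (s - t) - u' = (u s - u t - (s - t) *\<^sub>R u') /\<^sub>R (s - t)"
      by (simp add: scaleR_diff_right)
    then show "norm (u s - u t - (s - t) *\<^sub>R u') / norm (s - t) = norm ((u s - u t) /\<^sub>R (s - t) - u')"
      by (simp add: divide_simps)
  qed
  ultimately have "((\<lambda>s. norm ((u s - u t) /\<^sub>R (s - t) - u')) \<longlongrightarrow> 0) (at t within X)"
    by (rule Lim_transform_eventually)
  then show ?thesis by (rule LIM_zero_cancel[OF tendsto_norm_zero_cancel])
qed

text \<open>The inner product of the two difference quotients is a square times the monotonicity
  expression, and nonnegativity survives the limit. Only derivatives along the curve enter, so the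
  operator itself may be nondifferentiable.\<close>

lemma monotone_along_curve:
  fixes u v :: "real \<Rightarrow> 'a::real_inner"
  assumes u: "(u has_vector_derivative u') (at t within {a..})"
    and v: "(v has_vector_derivative v') (at t within {a..})"
    and "a \<le> t" and mono: "\<And>s. a \<le> s \<Longrightarrow> 0 \<le> (u s - u t) \<bullet> (v s - v t)"
  shows "0 \<le> u' \<bullet> v'"
proof -
  have "at t within {a..} \<noteq> bot"
  proof -
    \<comment> \<open>The right-hand filter also covers the endpoint \<open>t = a\<close>.\<close>
    have "at_right t \<le> at t within {a..}" using \<open>a \<le> t\<close> by (intro at_le) auto
    then show ?thesis by (metis bot.extremum_uniqueI trivial_limit_at_right_real)
  qed
  moreover have "((\<lambda>s. ((u s - u t) /\<^sub>R (s - t)) \<bullet> ((v s - v t) /\<^sub>R (s - t))) \<longlongrightarrow> u' \<bullet> v')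
      (at t within {a..})"
    using u v by (intro tendsto_inner has_vector_derivative_imp_tendsto_quotient)
  moreover have "\<forall>\<^sub>F s in at t within {a..}. 0 \<le> ((u s - u t) /\<^sub>R (s - t)) \<bullet> ((v s - v t) /\<^sub>R (s - t))"
    unfolding eventually_at_filter
  proof (rule always_eventually, intro allI impI)
    fix s assume "s \<noteq> t" "s \<in> {a..}"
    have "((u s - u t) /\<^sub>R (s - t)) \<bullet> ((v s - v t) /\<^sub>R (s - t))
        = (inverse (s - t))\<^sup>2 * ((u s - u t) \<bullet> (v s - v t))" by (simp add: power2_eq_square mult.assoc)
    then show "0 \<le> ((u s - u t) /\<^sub>R (s - t)) \<bullet> ((v s - v t) /\<^sub>R (s - t))"
      using mono[of s] \<open>s \<in> {a..}\<close> by (metis atLeast_iff mult_nonneg_nonneg zero_le_power2)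
  qed
  ultimately show ?thesis by (intro tendsto_lowerbound)
qed

section \<open>A dissipation criterion for convergence to zero\<close>

lemma antimono_bounded_below_converges:
  fixes g :: "real \<Rightarrow> real"
  assumes dec: "\<And>s t. T \<le> s \<Longrightarrow> s \<le> t \<Longrightarrow> g t \<le> g s" and lower: "\<And>t. T \<le> t \<Longrightarrow> m \<le> g t"
  obtains l where "(g \<longlongrightarrow> l) at_top"
proof
  have bdd: "bdd_below (g ` {T..})" using lower by (intro bdd_belowI[of _ m]) auto
  show "(g \<longlongrightarrow> Inf (g ` {T..})) at_top"
  proof (rule decreasing_tendsto)
    show "\<forall>\<^sub>F t in at_top. Inf (g ` {T..}) \<le> g t"
      using eventually_ge_at_top[of T] by eventually_elim (auto intro: cInf_lower bdd)
    fix y assume "Inf (g ` {T..}) < y"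
    then obtain s where s: "T \<le> s" "g s < y"
      using cInf_lessD[of "g ` {T..}" y] by auto
    show "\<forall>\<^sub>F t in at_top. g t < y"
      using eventually_ge_at_top[of s] by eventually_elim (use dec s in force)
  qed
qed

text \<open>Replaces a Gronwall argument with integrable forcing: \<open>p\<close> obeys a damped
  inequality in the time scale \<open>S\<close>, and the decrease of \<open>Q\<close> pays for the
  forcing. Both \<open>Q\<close> and \<open>p + Q\<close> are nonincreasing and bounded below, so
  \<open>p\<close> has a limit; a positive limit would make \<open>p + Q\<close> fall without bound
  because \<open>S\<close> is unbounded.\<close>

lemma tendsto_zero_of_dissipation:
  fixes p Q S :: "real \<Rightarrow> real"
  assumes p: "\<And>t. T \<le> t \<Longrightarrow> (p has_real_derivative p' t) (at t)"
    and Q: "\<And>t. T \<le> t \<Longrightarrow> (Q has_real_derivative Q' t) (at t)"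
    and S: "\<And>t. T \<le> t \<Longrightarrow> (S has_real_derivative S' t) (at t)"
    and S'_nonneg: "\<And>t. T \<le> t \<Longrightarrow> 0 \<le> S' t" and S_top: "filterlim S at_top at_top"
    and p_nonneg: "\<And>t. T \<le> t \<Longrightarrow> 0 \<le> p t" and Q_nonneg: "\<And>t. T \<le> t \<Longrightarrow> 0 \<le> Q t"
    and Q'_nonpos: "\<And>t. T \<le> t \<Longrightarrow> Q' t \<le> 0" and "\<delta> > 0"
    and diss: "\<And>t. T \<le> t \<Longrightarrow> p' t + Q' t \<le> - (\<delta> * S' t * p t)"
  shows "(p \<longlongrightarrow> 0) at_top"
proof -
  have Qdec: "Q t \<le> Q s" if "T \<le> s" "s \<le> t" for s t
    using that Q Q'_nonpos by (intro DERIV_nonpos_imp_nonincreasing[OF that(2)]) (meson order_trans)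
  have Rder: "((\<lambda>t. p t + Q t) has_real_derivative p' t + Q' t) (at t)" if "T \<le> t" for t
    using p Q that by (intro DERIV_add) auto
  have Rdec: "p t + Q t \<le> p s + Q s" if "T \<le> s" "s \<le> t" for s t
  proof (rule DERIV_nonpos_imp_nonincreasing[OF that(2)])
    fix x assume "s \<le> x" "x \<le> t"
    then have "T \<le> x" using that by simp
    have "0 \<le> \<delta> * S' x * p x"
      using \<open>\<delta> > 0\<close> S'_nonneg[OF \<open>T \<le> x\<close>] p_nonneg[OF \<open>T \<le> x\<close>] by simp
    then have "p' x + Q' x \<le> 0" using diss[OF \<open>T \<le> x\<close>] by linarith
    then show "\<exists>y. ((\<lambda>t. p t + Q t) has_real_derivative y) (at x) \<and> y \<le> 0"
      using Rder[OF \<open>T \<le> x\<close>] by blast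
  qed
  obtain lQ where lQ: "(Q \<longlongrightarrow> lQ) at_top"
    using antimono_bounded_below_converges[of T Q 0] Qdec Q_nonneg by metis
  obtain lR where lR: "((\<lambda>t. p t + Q t) \<longlongrightarrow> lR) at_top"
    by (rule antimono_bounded_below_converges[of T "\<lambda>t. p t + Q t" 0])
       (auto intro: Rdec add_nonneg_nonneg p_nonneg Q_nonneg)
  have lim: "(p \<longlongrightarrow> lR - lQ) at_top" using tendsto_diff[OF lR lQ] by simp
  have "\<forall>\<^sub>F t in at_top. 0 \<le> p t" using eventually_ge_at_top[of T] by eventually_elim (rule p_nonneg)
  then have "0 \<le> lR - lQ" by (rule tendsto_lowerbound[OF lim]) simp
  moreover have "\<not> 0 < lR - lQ"
  proof
    define m where "m = (lR - lQ) / 2"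
    assume "0 < lR - lQ"
    then have "m > 0" "m < lR - lQ" by (simp_all add: m_def)
    then have "\<forall>\<^sub>F t in at_top. m < p t" using lim by (simp add: order_tendsto_iff)
    then obtain T2 where T2: "\<And>t. T2 \<le> t \<Longrightarrow> m < p t" unfolding eventually_at_top_linorder by blast
    define T3 where "T3 = max T T2"
    \<comment> \<open>While \<open>p\<close> exceeds \<open>m\<close>, half its supposed limit, the
      sum \<open>p + Q + \<delta> * m * S\<close> is nonincreasing, which caps
      \<open>S\<close>.\<close>
    have bound: "\<delta> * m * S t \<le> \<delta> * m * S T3 + (p T3 + Q T3)" if "T3 \<le> t" for t
    proof -
      have "(p t + Q t) + \<delta> * m * S t \<le> (p T3 + Q T3) + \<delta> * m * S T3"
      proof (rule DERIV_nonpos_imp_nonincreasing[OF that])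
        fix x assume "T3 \<le> x" "x \<le> t"
        then have x: "T \<le> x" "T2 \<le> x" by (simp_all add: T3_def)
        have "\<delta> * S' x * m \<le> \<delta> * S' x * p x"
          using \<open>\<delta> > 0\<close> S'_nonneg[OF x(1)] T2[OF x(2)] by (intro mult_left_mono) auto
        then have "p' x + Q' x + \<delta> * m * S' x \<le> 0"
          using diss[OF x(1)] by (simp add: mult_ac)
        moreover have "((\<lambda>t. (p t + Q t) + \<delta> * m * S t) has_real_derivative
            p' x + Q' x + \<delta> * m * S' x) (at x)"
          by (intro DERIV_add Rder DERIV_cmult S x)
        ultimately show "\<exists>y. ((\<lambda>t. (p t + Q t) + \<delta> * m * S t) has_real_derivative y) (at x) \<and> y \<le> 0"
          by blast
      qed
      moreover have "0 \<le> p t + Q t"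
        using that p_nonneg[of t] Q_nonneg[of t] by (simp add: T3_def)
      ultimately show ?thesis by linarith
    qed
    have "\<forall>\<^sub>F t in at_top. (\<delta> * m * S T3 + (p T3 + Q T3)) / (\<delta> * m) < S t"
      using S_top by (simp add: filterlim_at_top_dense)
    then have "\<forall>\<^sub>F t in at_top. T3 \<le> t \<and> (\<delta> * m * S T3 + (p T3 + Q T3)) / (\<delta> * m) < S t"
      using eventually_ge_at_top[of T3] by eventually_elim simp
    then obtain t where "T3 \<le> t" "(\<delta> * m * S T3 + (p T3 + Q T3)) / (\<delta> * m) < S t"
      using eventually_happens'[OF trivial_limit_at_top_linorder] by blast
    then show False using bound[of t] \<open>\<delta> > 0\<close> \<open>m > 0\<close> by (simp add: pos_divide_less_eq mult.commute)
  qed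
  ultimately have "lR - lQ = 0" by linarith
  then show ?thesis using lim by simp
qed

section \<open>Weak convergence in Hilbert spaces\<close>

text \<open>Weak compactness in filter form: vectors are viewed as functions
  \<open>v \<mapsto> u i \<bullet> v\<close> in a product of compact intervals. Tychonoff gives a
  cluster point, a finer filter converges to it, and Riesz turns this linear functional into a
  vector.\<close>

lemma bounded_imp_weak_cluster:
  fixes u :: "'i \<Rightarrow> 'a::{real_inner, complete_space}"
  assumes "F \<noteq> bot" and bdd: "\<forall>\<^sub>F i in F. norm (u i) \<le> K"
  obtains F' w where "F' \<le> F" "F' \<noteq> bot" "\<And>v. ((\<lambda>i. u i \<bullet> v) \<longlongrightarrow> w \<bullet> v) F'"
proof -
  define \<Psi> where "\<Psi> i = (\<lambda>v. u i \<bullet> v)" for i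
  define U where "U = PiE (UNIV :: 'a set) (\<lambda>v. {- (K * norm v) .. K * norm v})"
  have "compact U"
  proof -
    have "compactin (product_topology (\<lambda>i. euclidean) UNIV) U"
      unfolding U_def compactin_PiE by simp
    then show ?thesis by (simp add: euclidean_product_topology)
  qed
  have "\<forall>\<^sub>F i in F. \<Psi> i \<in> U"
    using bdd
  proof eventually_elim
    case (elim i)
    have "\<bar>u i \<bullet> v\<bar> \<le> K * norm v" for v
      using Cauchy_Schwarz_ineq2 mult_right_mono[OF elim norm_ge_zero] by (rule order_trans)
    then show ?case by (auto simp: U_def \<Psi>_def abs_le_iff minus_le_iff)
  qed
  then have "\<forall>\<^sub>F h in filtermap \<Psi> F. h \<in> U" by (simp add: eventually_filtermap)
  then obtain \<phi> where \<phi>: "\<phi> \<in> U" and cl: "inf (nhds \<phi>) (filtermap \<Psi> F) \<noteq> bot"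
    using \<open>compact U\<close> \<open>F \<noteq> bot\<close> unfolding compact_filter by (metis filtermap_bot_iff)
  \<comment> \<open>The finer filter plays the role of a convergent subnet; it is proper because
    \<open>\<phi>\<close> is a cluster point.\<close>
  define F' where "F' = inf F (filtercomap \<Psi> (nhds \<phi>))"
  have "F' \<le> F" by (simp add: F'_def)
  have "F' \<noteq> bot"
  proof
    assume "F' = bot"
    then have "eventually (\<lambda>_. False) F'" by simp
    then obtain P Q where P: "eventually P F" and Q: "eventually Q (nhds \<phi>)"
      and PQ: "\<And>i. P i \<Longrightarrow> \<not> Q (\<Psi> i)"
      unfolding F'_def eventually_inf eventually_filtercomap by blast
    have "eventually (\<lambda>h. \<not> Q h) (filtermap \<Psi> F)"
      unfolding eventually_filtermap using P by eventually_elim (rule PQ)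
    then have "eventually (\<lambda>_. False) (inf (nhds \<phi>) (filtermap \<Psi> F))"
      unfolding eventually_inf using Q by blast
    then show False using cl by simp
  qed
  have "filterlim \<Psi> (nhds \<phi>) F'"
    unfolding F'_def by (rule filterlim_mono[OF filterlim_filtercomap]) auto
  then have lim: "((\<lambda>i. u i \<bullet> v) \<longlongrightarrow> \<phi> v) F'" for v
  proof -
    have cont: "continuous_on UNIV (\<lambda>h :: 'a \<Rightarrow> real. h v)" by (rule continuous_on_product_coordinates)
    have "((\<lambda>h :: 'a \<Rightarrow> real. h v) \<longlongrightarrow> \<phi> v) (nhds \<phi>)"
    proof (rule topological_tendstoI)
      fix X :: "real set" assume "open X" "\<phi> v \<in> X"
      then show "\<forall>\<^sub>F h in nhds \<phi>. h v \<in> X"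
        using open_vimage[OF _ cont, of X] unfolding eventually_nhds by (metis vimageE vimageI)
    qed
    from filterlim_compose[OF this \<open>filterlim \<Psi> (nhds \<phi>) F'\<close>]
    show ?thesis by (simp add: \<Psi>_def)
  qed
  have "bounded_linear \<phi>"
  proof (rule bounded_linear_intro)
    show "\<phi> (x + y) = \<phi> x + \<phi> y" for x y
      using tendsto_unique[OF \<open>F' \<noteq> bot\<close> lim[of "x + y"]] tendsto_add[OF lim[of x] lim[of y]]
      by (simp add: inner_add_right)
    show "\<phi> (s *\<^sub>R x) = s *\<^sub>R \<phi> x" for s x
      using tendsto_unique[OF \<open>F' \<noteq> bot\<close> lim[of "s *\<^sub>R x"]] tendsto_scaleR[OF tendsto_const lim[of x], of s]
      by simp
    show "norm (\<phi> x) \<le> norm x * K" for x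
    proof -
      have "\<phi> x \<in> {- (K * norm x) .. K * norm x}" using \<phi> unfolding U_def by blast
      then show ?thesis by (auto simp: mult.commute)
    qed
  qed
  then obtain w where "\<And>v. \<phi> v = v \<bullet> w" using riesz_representation by blast
  then have "((\<lambda>i. u i \<bullet> v) \<longlongrightarrow> w \<bullet> v) F'" for v using lim[of v] by (simp add: inner_commute)
  with \<open>F' \<le> F\<close> \<open>F' \<noteq> bot\<close> show ?thesis by (rule that)
qed

text \<open>Any two weak cluster points lie in \<open>Z\<close>, and convergence of the distances to
  both forces them to coincide; with weak compactness, a unique cluster point is the limit of the
  whole filter.\<close>

lemma opial:
  fixes u :: "'i \<Rightarrow> 'a::{real_inner, complete_space}"
  assumes "F \<noteq> bot" and bdd: "\<forall>\<^sub>F i in F. norm (u i) \<le> K"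
    and dist: "\<And>p. p \<in> Z \<Longrightarrow> \<exists>l. ((\<lambda>i. (norm (u i - p))\<^sup>2) \<longlongrightarrow> l) F"
    and cluster: "\<And>F' w. F' \<le> F \<Longrightarrow> F' \<noteq> bot \<Longrightarrow> (\<And>v. ((\<lambda>i. u i \<bullet> v) \<longlongrightarrow> w \<bullet> v) F') \<Longrightarrow> w \<in> Z"
  obtains w where "w \<in> Z" "\<And>v. ((\<lambda>i. u i \<bullet> v) \<longlongrightarrow> w \<bullet> v) F"
proof -
  obtain F1 w where F1: "F1 \<le> F" "F1 \<noteq> bot" and w: "\<And>v. ((\<lambda>i. u i \<bullet> v) \<longlongrightarrow> w \<bullet> v) F1"
    using bounded_imp_weak_cluster[OF assms(1) bdd] by metis
  have wZ: "w \<in> Z" using cluster F1 w by blast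
  have uniq: "y = w" if F2: "F2 \<le> F" "F2 \<noteq> bot" and y: "\<And>v. ((\<lambda>i. u i \<bullet> v) \<longlongrightarrow> y \<bullet> v) F2" for F2 y
  proof -
    have yZ: "y \<in> Z" using cluster F2 y by blast
    obtain ly lw where ly: "((\<lambda>i. (norm (u i - y))\<^sup>2) \<longlongrightarrow> ly) F"
      and lw: "((\<lambda>i. (norm (u i - w))\<^sup>2) \<longlongrightarrow> lw) F" using dist yZ wZ by blast
    \<comment> \<open>The quadratic terms cancel, so convergence of the two distances is convergence
      of \<open>u i \<bullet> (w - y)\<close> along all of \<open>F\<close>; its limit is then read
      off along both finer filters.\<close>
    have "((\<lambda>i. ((norm (u i - y))\<^sup>2 - (norm (u i - w))\<^sup>2 - y \<bullet> y + w \<bullet> w) / 2)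
        \<longlongrightarrow> (ly - lw - y \<bullet> y + w \<bullet> w) / 2) F"
      by (intro tendsto_intros ly lw) simp
    moreover have "((norm (u i - y))\<^sup>2 - (norm (u i - w))\<^sup>2 - y \<bullet> y + w \<bullet> w) / 2 = u i \<bullet> (w - y)" for i
      by (simp add: power2_norm_eq_inner inner_diff_left inner_diff_right inner_commute)
    ultimately obtain l where l: "((\<lambda>i. u i \<bullet> (w - y)) \<longlongrightarrow> l) F" by auto
    have "w \<bullet> (w - y) = l"
      using tendsto_unique[OF F1(2) w tendsto_mono[OF F1(1) l]] .
    moreover have "y \<bullet> (w - y) = l"
      using tendsto_unique[OF F2(2) y tendsto_mono[OF F2(1) l]] .
    ultimately have "(w - y) \<bullet> (w - y) = 0" by (simp add: inner_diff_left)
    then show ?thesis by simp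
  qed
  have "((\<lambda>i. u i \<bullet> v) \<longlongrightarrow> w \<bullet> v) F" for v
  proof (rule ccontr)
    assume "\<not> ((\<lambda>i. u i \<bullet> v) \<longlongrightarrow> w \<bullet> v) F"
    then obtain e where "e > 0" and freq: "\<not> (\<forall>\<^sub>F i in F. dist (u i \<bullet> v) (w \<bullet> v) < e)"
      unfolding tendsto_iff by blast
    \<comment> \<open>Restricting to the indices that stay away from \<open>w\<close> in direction
      \<open>v\<close> gives a proper filter, whose cluster point must again be
      \<open>w\<close>.\<close>
    define F0 where "F0 = inf F (principal {i. \<not> dist (u i \<bullet> v) (w \<bullet> v) < e})"
    have "F0 \<noteq> bot" using freq by (auto simp: F0_def trivial_limit_def eventually_inf_principal)
    have "F0 \<le> F" by (simp add: F0_def)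
    then have "\<forall>\<^sub>F i in F0. norm (u i) \<le> K" using bdd by (rule filter_leD)
    then obtain F2 y where F2: "F2 \<le> F0" "F2 \<noteq> bot" and y: "\<And>v. ((\<lambda>i. u i \<bullet> v) \<longlongrightarrow> y \<bullet> v) F2"
      using bounded_imp_weak_cluster[OF \<open>F0 \<noteq> bot\<close>] by metis
    have "y = w" using uniq[of F2 y] F2 y \<open>F0 \<le> F\<close> by (meson order_trans)
    then have "\<forall>\<^sub>F i in F2. dist (u i \<bullet> v) (w \<bullet> v) < e" using y[of v] \<open>e > 0\<close> by (simp add: tendsto_iff)
    moreover have "\<forall>\<^sub>F i in F2. \<not> dist (u i \<bullet> v) (w \<bullet> v) < e"
      by (rule filter_leD[OF F2(1)]) (auto simp: F0_def eventually_inf_principal)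
    ultimately have "\<forall>\<^sub>F i in F2. False" by eventually_elim blast
    then show False using F2(2) by simp
  qed
  with wZ show ?thesis by (rule that)
qed

text \<open>Minty's argument: monotonicity passes to the limit as an inequality tested at every
  \<open>p\<close>, and testing near \<open>w\<close> recovers the equation. This identifies weak
  cluster points of the orbit as zeros.\<close>

lemma monotone_weak_strong_closed:
  fixes T :: "'a::real_inner \<Rightarrow> 'a"
  assumes mono: "\<And>p q. 0 \<le> (T p - T q) \<bullet> (p - q)" and cont: "continuous_on UNIV T"
    and "F \<noteq> bot" and bdd: "\<forall>\<^sub>F i in F. norm (u i) \<le> K"
    and weak: "\<And>v. ((\<lambda>i. u i \<bullet> v) \<longlongrightarrow> w \<bullet> v) F"
    and strong: "((\<lambda>i. T (u i)) \<longlongrightarrow> 0) F"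
  shows "T w = 0"
proof -
  have minty: "0 \<le> T p \<bullet> (p - w)" for p
  proof (rule tendsto_lowerbound)
    have "Bfun u F" using bdd by (rule BfunI)
    moreover have "Zfun (\<lambda>i. T (u i)) F" using strong by (simp add: tendsto_Zfun_iff)
    ultimately have "Zfun (\<lambda>i. T (u i) \<bullet> u i) F"
      by (intro bounded_bilinear.Zfun_prod_Bfun[OF bounded_bilinear_inner])
    then have "((\<lambda>i. T (u i) \<bullet> u i) \<longlongrightarrow> 0) F" by (simp add: tendsto_Zfun_iff)
    moreover have "((\<lambda>i. T (u i) \<bullet> p) \<longlongrightarrow> 0 \<bullet> p) F" by (intro tendsto_intros strong)
    ultimately have "((\<lambda>i. T p \<bullet> p - u i \<bullet> T p - T (u i) \<bullet> p + T (u i) \<bullet> u i)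
        \<longlongrightarrow> T p \<bullet> p - w \<bullet> T p - 0 \<bullet> p + 0) F"
      by (intro tendsto_diff tendsto_add tendsto_const weak)
    moreover have "T p \<bullet> p - u i \<bullet> T p - T (u i) \<bullet> p + T (u i) \<bullet> u i = (T p - T (u i)) \<bullet> (p - u i)" for i
      by (simp add: inner_diff_left inner_diff_right inner_commute)
    moreover have "T p \<bullet> p - w \<bullet> T p - 0 \<bullet> p + 0 = T p \<bullet> (p - w)"
      by (simp add: inner_diff_right inner_commute)
    ultimately show "((\<lambda>i. (T p - T (u i)) \<bullet> (p - u i)) \<longlongrightarrow> T p \<bullet> (p - w)) F"
      by (simp only:)
    show "\<forall>\<^sub>F i in F. 0 \<le> (T p - T (u i)) \<bullet> (p - u i)" using mono by simp
  qed fact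
  \<comment> \<open>The test point \<open>w - s *\<^sub>R T w\<close> allows division by
    \<open>s\<close>; letting \<open>s\<close> tend to zero then gives
    \<open>T w \<bullet> T w \<le> 0\<close> by continuity.\<close>
  have le: "0 \<le> T (w - s *\<^sub>R T w) \<bullet> (- T w)" if "s > 0" for s
    using minty[of "w - s *\<^sub>R T w"] that by (simp add: zero_le_mult_iff mult_le_0_iff)
  have "((\<lambda>s. T (w - s *\<^sub>R T w) \<bullet> (- T w)) \<longlongrightarrow> T (w - 0 *\<^sub>R T w) \<bullet> (- T w)) (at_right 0)"
  proof (intro tendsto_intros)
    have "isCont T (w - 0 *\<^sub>R T w)" using cont by (simp add: continuous_on_eq_continuous_at)
    then show "((\<lambda>s. T (w - s *\<^sub>R T w)) \<longlongrightarrow> T (w - 0 *\<^sub>R T w)) (at_right 0)"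
      by (rule isCont_tendsto_compose) (intro tendsto_intros)
  qed
  moreover have "\<forall>\<^sub>F s in at_right (0::real). 0 \<le> T (w - s *\<^sub>R T w) \<bullet> (- T w)"
    using eventually_at_right_less[of 0] by eventually_elim (rule le)
  ultimately have "0 \<le> T w \<bullet> (- T w)" using tendsto_lowerbound by fastforce
  then have "T w \<bullet> T w \<le> 0" by simp
  then show ?thesis by (metis inner_eq_zero_iff inner_ge_zero order_antisym)
qed

section \<open>Second-order flows of monotone operators\<close>

lemma has_real_derivative_inner:
  assumes "(f has_vector_derivative f') (at t within X)" "(g has_vector_derivative g') (at t within X)"
  shows "((\<lambda>s. f s \<bullet> g s) has_real_derivative f t \<bullet> g' + f' \<bullet> g t) (at t within X)"
  using bounded_bilinear.has_vector_derivative[OF bounded_bilinear_inner assms]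
  by (simp add: has_real_derivative_iff_has_vector_derivative)

lemma young_inequality:
  fixes x y e :: real
  assumes "e > 0"
  shows "x * y \<le> e / 2 * x\<^sup>2 + y\<^sup>2 / (2 * e)"
proof -
  have "0 \<le> (e * x - y)\<^sup>2" by simp
  then have "2 * e * (x * y) \<le> e\<^sup>2 * x\<^sup>2 + y\<^sup>2" by (simp add: power2_diff power_mult_distrib)
  then show ?thesis using assms by (simp add: field_simps power2_eq_square)
qed

lemma tendsto_inner_bounded_zero:
  fixes f g :: "'i \<Rightarrow> 'a::real_inner"
  assumes "\<forall>\<^sub>F i in F. norm (f i) \<le> K" and "(g \<longlongrightarrow> 0) F"
  shows "((\<lambda>i. f i \<bullet> g i) \<longlongrightarrow> 0) F"
proof (rule Lim_null_comparison)
  show "\<forall>\<^sub>F i in F. norm (f i \<bullet> g i) \<le> K * norm (g i)"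
    using assms(1)
  proof eventually_elim
    case (elim i)
    show ?case using Cauchy_Schwarz_ineq2[of "f i" "g i"] mult_right_mono[OF elim norm_ge_zero[of "g i"]]
      by (metis real_norm_def order_trans)
  qed
  show "((\<lambda>i. K * norm (g i)) \<longlongrightarrow> 0) F"
    using tendsto_mult_right_zero[OF tendsto_norm_zero[OF assms(2)]] .
qed

text \<open>With \<open>\<tau> = t\<^sup>r\<close> and \<open>B = t\<^sup>2\<^sup>r \<beta>\<close>, this is the second-order equation
  \<open>z'' + \<alpha> / \<tau> z' + \<theta> \<tau> \<beta> (d/dt) v + \<beta> v = 0\<close> multiplied by \<open>\<tau>\<close>, where \<open>v\<close> is a monotone operator
  along \<open>z\<close> and \<open>zs\<close> is one of its zeros. The function \<open>S\<close> is the time change with \<open>dS = dt / \<tau>\<close>.\<close>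
locale monotone_flow =
  fixes z z' z'' v v' :: "real \<Rightarrow> 'c::real_inner"
    and \<tau> \<tau>' \<tau>'' B B' S :: "real \<Rightarrow> real" and T \<alpha> \<theta> c k l :: real and zs :: 'c
  assumes z_deriv: "\<And>t. T \<le> t \<Longrightarrow> (z has_vector_derivative z' t) (at t)"
    and z'_deriv: "\<And>t. T \<le> t \<Longrightarrow> (z' has_vector_derivative z'' t) (at t)"
    and v_deriv: "\<And>t. T \<le> t \<Longrightarrow> (v has_vector_derivative v' t) (at t)"
    and equation: "\<And>t. T \<le> t \<Longrightarrow>
      \<tau> t *\<^sub>R z'' t + \<alpha> *\<^sub>R z' t + (\<theta> * B t) *\<^sub>R v' t + (B t / \<tau> t) *\<^sub>R v t = 0"
    and monotone: "\<And>t. T \<le> t \<Longrightarrow> 0 \<le> z' t \<bullet> v' t"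
    and gap_nonneg: "\<And>t. T \<le> t \<Longrightarrow> 0 \<le> (z t - zs) \<bullet> v t"
    and \<tau>_pos: "\<And>t. T \<le> t \<Longrightarrow> 0 < \<tau> t"
    and \<tau>_deriv: "\<And>t. T \<le> t \<Longrightarrow> (\<tau> has_real_derivative \<tau>' t) (at t)"
    and \<tau>'_deriv: "\<And>t. T \<le> t \<Longrightarrow> (\<tau>' has_real_derivative \<tau>'' t) (at t)"
    and \<tau>'_nonneg: "\<And>t. T \<le> t \<Longrightarrow> 0 \<le> \<tau>' t"
    and \<tau>''_nonpos: "\<And>t. T \<le> t \<Longrightarrow> \<tau>'' t \<le> 0"
    and \<tau>'_lim: "(\<tau>' \<longlongrightarrow> l) at_top"
    and B_pos: "\<And>t. T \<le> t \<Longrightarrow> 0 < B t"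
    and B_deriv: "\<And>t. T \<le> t \<Longrightarrow> (B has_real_derivative B' t) (at t)"
    and B'_nonneg: "\<And>t. T \<le> t \<Longrightarrow> 0 \<le> B' t"
    and B'_le: "\<And>t. T \<le> t \<Longrightarrow> B' t * \<tau> t \<le> c * B t"
    and c_less: "c < 1 / \<theta>" and \<theta>_pos: "\<theta> > 0"
    and k_pos: "k > 0" and k_le: "\<And>t. T \<le> t \<Longrightarrow> k \<le> \<alpha> - 1 / \<theta> - \<tau>' t"
    and S_deriv: "\<And>t. T \<le> t \<Longrightarrow> (S has_real_derivative 1 / \<tau> t) (at t)"
    and S_top: "filterlim S at_top at_top"
begin

section \<open>The Lyapunov function and boundedness of the orbit\<close>

abbreviation \<eta> :: real where "\<eta> \<equiv> 1 / \<theta>"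

definition \<kappa> :: "real \<Rightarrow> real" where "\<kappa> t = \<alpha> - \<eta> - \<tau>' t"

definition energy :: "real \<Rightarrow> real" where
  "energy t = (1/2) * ((\<eta> *\<^sub>R (z t - zs) + \<tau> t *\<^sub>R z' t) \<bullet> (\<eta> *\<^sub>R (z t - zs) + \<tau> t *\<^sub>R z' t))
     + B t * ((z t - zs) \<bullet> v t) + \<eta> / 2 * \<kappa> t * ((z t - zs) \<bullet> (z t - zs))"

text \<open>The weight \<open>\<kappa>\<close> grows where \<open>\<tau>'' < 0\<close>, which adds a
  nonnegative multiple of the squared distance to the derivative of \<open>energy\<close>; dividing
  by \<open>\<kappa>\<close> compensates for it.\<close>

definition lyap :: "real \<Rightarrow> real" where "lyap t = energy t / \<kappa> t"

text \<open>In its derivative the equation eliminates both \<open>z''\<close> and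
  \<open>v'\<close>.\<close>

definition momentum :: "real \<Rightarrow> 'c" where "momentum t = \<tau> t *\<^sub>R z' t + (\<theta> * B t) *\<^sub>R v t"

lemma \<kappa>_pos: "T \<le> t \<Longrightarrow> 0 < \<kappa> t"
  using k_le[of t] k_pos by (simp add: \<kappa>_def)

lemma energy_ge: "T \<le> t \<Longrightarrow> \<eta> / 2 * \<kappa> t * ((z t - zs) \<bullet> (z t - zs)) \<le> energy t"
  unfolding energy_def using B_pos[of t] gap_nonneg[of t] by simp

lemma lyap_ge: "T \<le> t \<Longrightarrow> \<eta> / 2 * ((z t - zs) \<bullet> (z t - zs)) \<le> lyap t"
  unfolding lyap_def using energy_ge[of t] \<kappa>_pos[of t] by (simp add: pos_le_divide_eq mult_ac)

lemma lyap_nonneg: "T \<le> t \<Longrightarrow> 0 \<le> lyap t"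
  using lyap_ge[of t] \<theta>_pos by (meson divide_nonneg_nonneg inner_ge_zero less_imp_le mult_nonneg_nonneg
      order_trans zero_le_numeral zero_le_one)

lemma equation': "T \<le> t \<Longrightarrow>
    \<tau> t *\<^sub>R z'' t = - (\<alpha> *\<^sub>R z' t + (\<theta> * B t) *\<^sub>R v' t + (B t / \<tau> t) *\<^sub>R v t)"
  using equation[of t] by (simp only: eq_neg_iff_add_eq_0 add.assoc)

text \<open>In the derivative of \<open>energy\<close> the products of \<open>y\<close> with
  \<open>a\<close>, \<open>y\<close> with \<open>V'\<close> and \<open>a\<close> with
  \<open>V\<close> cancel. Monotonicity and the growth condition give the signs of the rest, except
  for the \<open>\<tau>''\<close> term, which the quotient rule absorbs.\<close>

lemma lyap_deriv_ex:
  assumes t: "T \<le> t"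
  shows "\<exists>D. (lyap has_real_derivative D) (at t) \<and> D \<le> - (\<tau> t * (z' t \<bullet> z' t))"
proof -
  define y a V V' where "y = z t - zs" and "a = z' t" and "V = v t" and "V' = v' t"
  define w where "w = \<eta> *\<^sub>R y + \<tau> t *\<^sub>R a"
  have \<tau>: "\<tau> t > 0" and B: "B t > 0" and \<kappa>: "\<kappa> t > 0" using t \<tau>_pos B_pos \<kappa>_pos by auto
  have "\<tau> t *\<^sub>R z'' t = - (\<alpha> *\<^sub>R a + (\<theta> * B t) *\<^sub>R V' + (B t / \<tau> t) *\<^sub>R V)"
    using equation'[OF t] unfolding a_def V_def V'_def .
  then have w': "\<eta> *\<^sub>R a + (\<tau> t *\<^sub>R z'' t + \<tau>' t *\<^sub>R a)
      = - (\<kappa> t *\<^sub>R a + (\<theta> * B t) *\<^sub>R V' + (B t / \<tau> t) *\<^sub>R V)"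
    by (simp add: \<kappa>_def algebra_simps)
  have "((\<lambda>s. z s - zs) has_vector_derivative a) (at t)"
    using z_deriv[OF t] by (auto intro!: derivative_eq_intros simp: a_def)
  note yd = this
  have "((\<lambda>s. \<eta> *\<^sub>R (z s - zs) + \<tau> s *\<^sub>R z' s) has_vector_derivative
      (\<eta> *\<^sub>R a + (\<tau> t *\<^sub>R z'' t + \<tau>' t *\<^sub>R a))) (at t)"
    using has_vector_derivative_add[OF
        bounded_linear.has_vector_derivative[OF bounded_linear_scaleR_right yd, of \<eta>]
        has_vector_derivative_scaleR[OF \<tau>_deriv[OF t] z'_deriv[OF t]]] by (simp add: a_def)
  note wd = this[unfolded w']
  have \<kappa>d: "(\<kappa> has_real_derivative - \<tau>'' t) (at t)"
    unfolding \<kappa>_def using \<tau>'_deriv[OF t] by (auto intro!: derivative_eq_intros)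
  define W where "W = w \<bullet> - (\<kappa> t *\<^sub>R a + (\<theta> * B t) *\<^sub>R V' + (B t / \<tau> t) *\<^sub>R V)"
  define D0 where "D0 = W + (B' t * (y \<bullet> V) + (y \<bullet> V' + a \<bullet> V) * B t)
      + (\<eta> / 2 * (- \<tau>'' t) * (y \<bullet> y) + (y \<bullet> a + a \<bullet> y) * (\<eta> / 2 * \<kappa> t))"
  have "((\<lambda>s. (1/2) * ((\<eta> *\<^sub>R (z s - zs) + \<tau> s *\<^sub>R z' s) \<bullet> (\<eta> *\<^sub>R (z s - zs) + \<tau> s *\<^sub>R z' s)))
      has_real_derivative W) (at t)"
    using DERIV_cmult[OF has_real_derivative_inner[OF wd wd], of "1/2"]
    unfolding W_def w_def y_def a_def by (simp only: inner_commute) (simp add: inner_commute)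
  moreover have "((\<lambda>s. B s * ((z s - zs) \<bullet> v s)) has_real_derivative
      B' t * (y \<bullet> V) + (y \<bullet> V' + a \<bullet> V) * B t) (at t)"
    using DERIV_mult[OF B_deriv[OF t] has_real_derivative_inner[OF yd v_deriv[OF t]]]
    by (simp add: y_def V_def V'_def)
  moreover have "((\<lambda>s. \<eta> / 2 * \<kappa> s * ((z s - zs) \<bullet> (z s - zs))) has_real_derivative
      \<eta> / 2 * (- \<tau>'' t) * (y \<bullet> y) + (y \<bullet> a + a \<bullet> y) * (\<eta> / 2 * \<kappa> t)) (at t)"
    using DERIV_mult[OF DERIV_cmult[OF \<kappa>d] has_real_derivative_inner[OF yd yd]]
    unfolding y_def by blast
  ultimately have Ed: "(energy has_real_derivative D0) (at t)"
    unfolding energy_def D0_def by (intro DERIV_add)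
  have W: "W = - \<kappa> t * \<eta> * (y \<bullet> a) - \<kappa> t * \<tau> t * (a \<bullet> a) - B t * (y \<bullet> V')
      - \<theta> * B t * \<tau> t * (a \<bullet> V') - \<eta> * B t / \<tau> t * (y \<bullet> V) - B t * (a \<bullet> V)"
    using \<tau> \<theta>_pos by (simp add: W_def w_def inner_add_left inner_add_right inner_diff_right field_simps)
  have D0: "D0 = - \<kappa> t * \<tau> t * (a \<bullet> a) - \<theta> * B t * \<tau> t * (a \<bullet> V')
      - (\<eta> * B t / \<tau> t - B' t) * (y \<bullet> V) - \<eta> / 2 * \<tau>'' t * (y \<bullet> y)"
    unfolding D0_def W by (simp add: inner_commute algebra_simps)
  \<comment> \<open>The growth condition makes the coefficient of the gap term
    \<open>y \<bullet> V\<close> favourable.\<close>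
  have "B' t * \<tau> t \<le> \<eta> * B t"
    using B'_le[OF t] mult_right_mono[OF less_imp_le[OF c_less] less_imp_le[OF B]] by (rule order_trans)
  then have "0 \<le> \<eta> * B t / \<tau> t - B' t" using \<tau> \<theta>_pos by (simp add: field_simps)
  then have "0 \<le> (\<eta> * B t / \<tau> t - B' t) * (y \<bullet> V)"
    using gap_nonneg[OF t] unfolding y_def V_def by (rule mult_nonneg_nonneg)
  moreover have "0 \<le> \<theta> * B t * \<tau> t * (a \<bullet> V')"
    using monotone[OF t] \<theta>_pos B \<tau> by (simp add: a_def V'_def)
  ultimately have le: "D0 + \<eta> / 2 * \<tau>'' t * (y \<bullet> y) \<le> - (\<kappa> t * \<tau> t * (a \<bullet> a))"
    unfolding D0 by linarith
  \<comment> \<open>Since \<open>\<tau>'' t \<le> 0\<close>, the lower bound for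
    \<open>energy\<close> reverses; this cancels the remaining term of \<open>D0\<close> in the
    quotient rule.\<close>
  have "energy t * \<tau>'' t \<le> \<eta> / 2 * \<kappa> t * (y \<bullet> y) * \<tau>'' t"
    using energy_ge[OF t] \<tau>''_nonpos[OF t] unfolding y_def by (intro mult_right_mono_neg) auto
  then have "D0 * \<kappa> t - energy t * (- \<tau>'' t) \<le> \<kappa> t * (D0 + \<eta> / 2 * \<tau>'' t * (y \<bullet> y))"
    by (simp add: algebra_simps)
  also have "\<dots> \<le> \<kappa> t * - (\<kappa> t * \<tau> t * (a \<bullet> a))" using le \<kappa> by (intro mult_left_mono) auto
  finally have "(D0 * \<kappa> t - energy t * (- \<tau>'' t)) / (\<kappa> t * \<kappa> t) \<le> - (\<tau> t * (a \<bullet> a))"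
    using \<kappa> by (simp add: pos_divide_le_eq mult_ac)
  moreover have "(lyap has_real_derivative (D0 * \<kappa> t - energy t * (- \<tau>'' t)) / (\<kappa> t * \<kappa> t)) (at t)"
    unfolding lyap_def using DERIV_divide[OF Ed \<kappa>d] \<kappa> by simp
  ultimately show ?thesis unfolding a_def by blast
qed

text \<open>Naming the derivative by \<open>deriv\<close> gives the function needed as
  \<open>Q'\<close> in the dissipation criterion.\<close>

lemma lyap_deriv:
  assumes "T \<le> t"
  shows "(lyap has_real_derivative deriv lyap t) (at t)"
    and "deriv lyap t \<le> - (\<tau> t * (z' t \<bullet> z' t))"
  using lyap_deriv_ex[OF assms] by (auto dest: DERIV_imp_deriv)

lemma lyap_antimono:
  assumes "T \<le> s" "s \<le> t"
  shows "lyap t \<le> lyap s"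
proof (rule DERIV_nonpos_imp_nonincreasing[OF \<open>s \<le> t\<close>])
  fix u assume "s \<le> u"
  then have u: "T \<le> u" using \<open>T \<le> s\<close> by simp
  then have "0 \<le> \<tau> u * (z' u \<bullet> z' u)" using \<tau>_pos[of u] by simp
  then show "\<exists>D. (lyap has_real_derivative D) (at u) \<and> D \<le> 0"
    using lyap_deriv_ex[OF u] by fastforce
qed

lemma bounded_orbit: "\<exists>K. \<forall>t\<ge>T. norm (z t - zs) \<le> K"
proof (intro exI allI impI)
  fix t assume t: "T \<le> t"
  have "\<eta> / 2 * (norm (z t - zs))\<^sup>2 \<le> lyap T"
    using lyap_ge[OF t] lyap_antimono[OF order_refl t] by (simp add: power2_norm_eq_inner)
  then have "(norm (z t - zs))\<^sup>2 \<le> 2 * \<theta> * lyap T" using \<theta>_pos by (simp add: field_simps)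
  then show "norm (z t - zs) \<le> sqrt (2 * \<theta> * lyap T)" by (rule real_le_rsqrt)
qed

section \<open>Decay of momentum and velocity in the rescaled time\<close>

definition \<delta> :: real where "\<delta> = \<eta> - c"

lemma \<delta>_pos: "\<delta> > 0" using c_less by (simp add: \<delta>_def)

definition mom2 :: "real \<Rightarrow> real" where "mom2 t = (1/2) * (momentum t \<bullet> momentum t)"

text \<open>Kinetic energy in the time scale \<open>S\<close>, where the velocity of
  \<open>z\<close> is \<open>\<tau> t *\<^sub>R z' t\<close>.\<close>

definition kin :: "real \<Rightarrow> real" where "kin t = (1/2) * ((\<tau> t *\<^sub>R z' t) \<bullet> (\<tau> t *\<^sub>R z' t))"

lemma mom2_nonneg: "0 \<le> mom2 t" and kin_nonneg: "0 \<le> kin t"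
  unfolding mom2_def kin_def by (intro mult_nonneg_nonneg inner_ge_zero; simp)+

text \<open>The derivative of \<open>mom2\<close> with \<open>v\<close> also eliminated, through the
  definition of \<open>momentum\<close>; what remains is damping of \<open>momentum\<close> forced
  by \<open>z'\<close>.\<close>

definition mom2' :: "real \<Rightarrow> real" where
  "mom2' t = momentum t \<bullet> (((\<eta> - B' t * \<tau> t / B t) - \<alpha> + \<tau>' t) *\<^sub>R z' t
     - ((\<eta> - B' t * \<tau> t / B t) / \<tau> t) *\<^sub>R momentum t)"

lemma mom2_deriv:
  assumes t: "T \<le> t"
  shows "(mom2 has_real_derivative mom2' t) (at t)"
proof -
  define n where "n = \<eta> - B' t * \<tau> t / B t"
  have \<tau>: "\<tau> t > 0" and B: "B t > 0" using t \<tau>_pos B_pos by auto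
  have "(momentum has_vector_derivative
      (\<tau> t *\<^sub>R z'' t + \<tau>' t *\<^sub>R z' t) + ((\<theta> * B t) *\<^sub>R v' t + (\<theta> * B' t) *\<^sub>R v t)) (at t)"
    unfolding momentum_def
    by (intro has_vector_derivative_add has_vector_derivative_scaleR DERIV_cmult
        \<tau>_deriv B_deriv z'_deriv v_deriv t)
  also have "(\<tau> t *\<^sub>R z'' t + \<tau>' t *\<^sub>R z' t) + ((\<theta> * B t) *\<^sub>R v' t + (\<theta> * B' t) *\<^sub>R v t)
      = (\<tau>' t - \<alpha>) *\<^sub>R z' t - (B t / \<tau> t - \<theta> * B' t) *\<^sub>R v t"
    unfolding equation'[OF t] by (simp add: algebra_simps)
  also have "(B t / \<tau> t - \<theta> * B' t) *\<^sub>R v t = (n / \<tau> t) *\<^sub>R (momentum t - \<tau> t *\<^sub>R z' t)"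
    using \<tau> B \<theta>_pos by (simp add: momentum_def n_def field_simps)
  also have "(\<tau>' t - \<alpha>) *\<^sub>R z' t - (n / \<tau> t) *\<^sub>R (momentum t - \<tau> t *\<^sub>R z' t)
      = (n - \<alpha> + \<tau>' t) *\<^sub>R z' t - (n / \<tau> t) *\<^sub>R momentum t"
    using \<tau> by (simp add: scaleR_diff_right scaleR_diff_left scaleR_add_left)
  finally have md: "(momentum has_vector_derivative
      ((n - \<alpha> + \<tau>' t) *\<^sub>R z' t - (n / \<tau> t) *\<^sub>R momentum t)) (at t)" .
  show ?thesis
    using DERIV_cmult[OF has_real_derivative_inner[OF md md], of "1/2"]
    unfolding mom2_def mom2'_def n_def[symmetric] by (simp add: inner_commute)
qed

text \<open>The slack \<open>\<delta>\<close> in the growth condition is the damping rate. Young's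
  inequality spends half of the damping on the cross term, and the forcing left over is a multiple
  of the dissipation of \<open>lyap\<close>.\<close>

lemma mom2'_le:
  assumes t: "T \<le> t"
  shows "mom2' t \<le> - (\<delta> * (1 / \<tau> t) * mom2 t) + \<alpha>\<^sup>2 / (2 * \<delta>) * (\<tau> t * (z' t \<bullet> z' t))"
proof -
  define n where "n = \<eta> - B' t * \<tau> t / B t"
  define M where "M = norm (momentum t)"
  define N where "N = norm (z' t)"
  have \<tau>: "\<tau> t > 0" and B: "B t > 0" using t \<tau>_pos B_pos by auto
  have "B' t * \<tau> t / B t \<le> c" using B'_le[OF t] B by (simp add: pos_divide_le_eq)
  then have n_ge: "\<delta> \<le> n" by (simp add: n_def \<delta>_def)
  have "0 \<le> B' t * \<tau> t / B t" using B'_nonneg[OF t] \<tau> B by simp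
  then have "n \<le> \<eta>" by (simp add: n_def)
  \<comment> \<open>The expression is negative because \<open>n \<le> \<eta>\<close> and
    \<open>\<tau>' t \<le> \<alpha> - \<eta> - k\<close>, and at least \<open>- \<alpha>\<close>
    because \<open>n\<close> and \<open>\<tau>' t\<close> are nonnegative.\<close>
  then have coeff: "\<bar>n - \<alpha> + \<tau>' t\<bar> \<le> \<alpha>"
    using n_ge \<delta>_pos k_le[OF t] k_pos \<tau>'_nonneg[OF t] by linarith
  have "(n - \<alpha> + \<tau>' t) * (momentum t \<bullet> z' t) \<le> \<bar>n - \<alpha> + \<tau>' t\<bar> * \<bar>momentum t \<bullet> z' t\<bar>"
    by (metis abs_ge_self abs_mult)
  also have "\<dots> \<le> \<alpha> * (M * N)"
    unfolding M_def N_def by (intro mult_mono coeff Cauchy_Schwarz_ineq2) (use coeff in auto)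
  also have "\<dots> = M * (\<alpha> * N)" by simp
  also have "\<dots> \<le> (\<delta> / \<tau> t) / 2 * M\<^sup>2 + (\<alpha> * N)\<^sup>2 / (2 * (\<delta> / \<tau> t))"
    using \<tau> \<delta>_pos by (intro young_inequality) simp
  finally have 1: "(n - \<alpha> + \<tau>' t) * (momentum t \<bullet> z' t)
      \<le> (\<delta> / \<tau> t * M\<^sup>2) / 2 + \<alpha>\<^sup>2 / (2 * \<delta>) * (\<tau> t * N\<^sup>2)"
    using \<tau> \<delta>_pos by (simp add: power_mult_distrib mult_ac)
  have 2: "\<delta> / \<tau> t * M\<^sup>2 \<le> n / \<tau> t * M\<^sup>2"
    using n_ge \<tau> by (intro mult_right_mono divide_right_mono) auto
  have "mom2' t = (n - \<alpha> + \<tau>' t) * (momentum t \<bullet> z' t) - n / \<tau> t * M\<^sup>2"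
    unfolding mom2'_def n_def[symmetric] M_def by (simp add: inner_diff_right power2_norm_eq_inner)
  moreover have mom2: "mom2 t = M\<^sup>2 / 2" by (simp add: mom2_def M_def power2_norm_eq_inner)
  \<comment> \<open>The nonlinear terms are treated as opaque variables in this purely linear
    inference.\<close>
  moreover have "p \<le> q / 2 + e \<Longrightarrow> q \<le> s \<Longrightarrow> p - s \<le> - (q / 2) + e" for p q s e :: real by linarith
  ultimately have "mom2' t \<le> - ((\<delta> / \<tau> t * M\<^sup>2) / 2) + \<alpha>\<^sup>2 / (2 * \<delta>) * (\<tau> t * N\<^sup>2)"
    using 1 2 by (simp only:)
  then show ?thesis unfolding mom2 N_def by (simp add: power2_norm_eq_inner)
qed

definition kin' :: "real \<Rightarrow> real" where
  "kin' t = (\<tau> t *\<^sub>R z' t) \<bullet> (\<tau> t *\<^sub>R z'' t + \<tau>' t *\<^sub>R z' t)"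

lemma kin_deriv:
  assumes t: "T \<le> t"
  shows "(kin has_real_derivative kin' t) (at t)"
proof -
  have d: "((\<lambda>s. \<tau> s *\<^sub>R z' s) has_vector_derivative \<tau> t *\<^sub>R z'' t + \<tau>' t *\<^sub>R z' t) (at t)"
    by (intro has_vector_derivative_scaleR \<tau>_deriv z'_deriv t)
  show ?thesis
    using DERIV_cmult[OF has_real_derivative_inner[OF d d], of "1/2"]
    unfolding kin_def kin'_def by (simp only: inner_commute) (simp add: inner_commute)
qed

text \<open>Substituting the equation and expressing \<open>v\<close> through
  \<open>momentum\<close> leaves damping at rate \<open>k\<close>, a monotone term of good sign, and
  \<open>momentum\<close> as forcing; Young's inequality with weight \<open>k * \<tau> t\<close>
  splits the product.\<close>

lemma kin'_le:
  assumes t: "T \<le> t"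
  shows "kin' t \<le> - (k * (1 / \<tau> t) * kin t) + \<eta>\<^sup>2 / k * (1 / \<tau> t * mom2 t)"
proof -
  define M where "M = norm (momentum t)"
  define N where "N = norm (z' t)"
  have \<tau>: "\<tau> t > 0" and B: "B t > 0" using t \<tau>_pos B_pos by auto
  have vt: "(B t / \<tau> t) *\<^sub>R v t = (\<eta> / \<tau> t) *\<^sub>R (momentum t - \<tau> t *\<^sub>R z' t)"
    using \<theta>_pos by (simp add: momentum_def)
  have "kin' t = - ((\<alpha> - \<eta> - \<tau>' t) * \<tau> t * N\<^sup>2) - \<theta> * B t * \<tau> t * (z' t \<bullet> v' t)
      - \<eta> * (z' t \<bullet> momentum t)"
    unfolding kin'_def N_def equation'[OF t] vt using \<tau> \<theta>_pos
    by (simp add: inner_diff_right inner_add_right power2_norm_eq_inner field_simps)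
  moreover have "k * \<tau> t * N\<^sup>2 \<le> (\<alpha> - \<eta> - \<tau>' t) * \<tau> t * N\<^sup>2"
    using k_le[OF t] \<tau> by (intro mult_right_mono) auto
  moreover have "0 \<le> \<theta> * B t * \<tau> t * (z' t \<bullet> v' t)" using monotone[OF t] \<theta>_pos B \<tau> by simp
  moreover have "- (\<eta> * (z' t \<bullet> momentum t)) \<le> (k * \<tau> t * N\<^sup>2) / 2 + \<eta>\<^sup>2 * M\<^sup>2 / (2 * (k * \<tau> t))"
  proof -
    have "- (z' t \<bullet> momentum t) \<le> N * M"
      using Cauchy_Schwarz_ineq2[of "z' t" "momentum t"] unfolding N_def M_def by linarith
    then have "\<eta> * - (z' t \<bullet> momentum t) \<le> \<eta> * (N * M)"
      using \<theta>_pos by (intro mult_left_mono) auto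
    also have "\<dots> = N * (\<eta> * M)" by simp
    also have "\<dots> \<le> k * \<tau> t / 2 * N\<^sup>2 + (\<eta> * M)\<^sup>2 / (2 * (k * \<tau> t))"
      using k_pos \<tau> by (intro young_inequality) simp
    finally show ?thesis by (simp add: power_mult_distrib power_divide)
  qed
  moreover have "p = - r - q - s \<Longrightarrow> o1 \<le> r \<Longrightarrow> 0 \<le> q \<Longrightarrow> - s \<le> o1 / 2 + e \<Longrightarrow> p \<le> - (o1 / 2) + e"
    for p q r s o1 e :: real by linarith
  ultimately have "kin' t \<le> - ((k * \<tau> t * N\<^sup>2) / 2) + \<eta>\<^sup>2 * M\<^sup>2 / (2 * (k * \<tau> t))"
    by blast
  moreover have mom2: "mom2 t = M\<^sup>2 / 2" by (simp add: mom2_def M_def power2_norm_eq_inner)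
  moreover have kin: "kin t = (\<tau> t)\<^sup>2 * N\<^sup>2 / 2"
    unfolding N_def power2_norm_eq_inner by (simp add: kin_def power2_eq_square)
  ultimately show ?thesis using \<tau> k_pos unfolding mom2 kin by (simp add: power2_eq_square mult_ac)
qed

lemma mom2_tendsto: "(mom2 \<longlongrightarrow> 0) at_top"
\<comment> \<open>The factor of \<open>lyap\<close> is the forcing constant of
  \<open>mom2'_le\<close>, so the decrease of \<open>lyap\<close> pays for the forcing
  exactly.\<close>
proof (rule tendsto_zero_of_dissipation[where Q = "\<lambda>t. \<alpha>\<^sup>2 / (2 * \<delta>) * lyap t"
      and Q' = "\<lambda>t. \<alpha>\<^sup>2 / (2 * \<delta>) * deriv lyap t" and p' = mom2' and S = S])
  fix t assume t: "T \<le> t"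
  have C: "0 \<le> \<alpha>\<^sup>2 / (2 * \<delta>)" using \<delta>_pos by simp
  have *: "\<alpha>\<^sup>2 / (2 * \<delta>) * deriv lyap t \<le> \<alpha>\<^sup>2 / (2 * \<delta>) * - (\<tau> t * (z' t \<bullet> z' t))"
    using lyap_deriv(2)[OF t] C by (rule mult_left_mono)
  then show "mom2' t + \<alpha>\<^sup>2 / (2 * \<delta>) * deriv lyap t \<le> - (\<delta> * (1 / \<tau> t) * mom2 t)"
    using mom2'_le[OF t] by linarith
  have "0 \<le> \<alpha>\<^sup>2 / (2 * \<delta>) * (\<tau> t * (z' t \<bullet> z' t))" using C \<tau>_pos[OF t] by (intro mult_nonneg_nonneg) auto
  with * show "\<alpha>\<^sup>2 / (2 * \<delta>) * deriv lyap t \<le> 0" by linarith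
  show "0 \<le> \<alpha>\<^sup>2 / (2 * \<delta>) * lyap t" using C lyap_nonneg[OF t] by (rule mult_nonneg_nonneg)
  show "(mom2 has_real_derivative mom2' t) (at t)" "0 \<le> mom2 t"
    by (rule mom2_deriv[OF t] mom2_nonneg)+
  show "((\<lambda>t. \<alpha>\<^sup>2 / (2 * \<delta>) * lyap t) has_real_derivative \<alpha>\<^sup>2 / (2 * \<delta>) * deriv lyap t) (at t)"
    by (intro DERIV_cmult lyap_deriv t)
  show "(S has_real_derivative 1 / \<tau> t) (at t)" by (rule S_deriv[OF t])
  show "0 \<le> 1 / \<tau> t" using \<tau>_pos[OF t] by simp
qed (fact S_top \<delta>_pos)+

lemma kin_tendsto: "(kin \<longlongrightarrow> 0) at_top"
\<comment> \<open>The bracket decreases at rate at least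
  \<open>\<delta> * (1 / \<tau> t) * mom2 t\<close>, so the factor
  \<open>\<eta>\<^sup>2 / k / \<delta>\<close> covers the forcing in \<open>kin'_le\<close>.\<close>
proof (rule tendsto_zero_of_dissipation[where
      Q = "\<lambda>t. \<eta>\<^sup>2 / k / \<delta> * (mom2 t + \<alpha>\<^sup>2 / (2 * \<delta>) * lyap t)"
      and Q' = "\<lambda>t. \<eta>\<^sup>2 / k / \<delta> * (mom2' t + \<alpha>\<^sup>2 / (2 * \<delta>) * deriv lyap t)" and p' = kin' and S = S])
  fix t assume t: "T \<le> t"
  have C: "0 \<le> \<alpha>\<^sup>2 / (2 * \<delta>)" "0 \<le> \<eta>\<^sup>2 / k / \<delta>" using \<delta>_pos k_pos by simp_all
  have "\<alpha>\<^sup>2 / (2 * \<delta>) * deriv lyap t \<le> \<alpha>\<^sup>2 / (2 * \<delta>) * - (\<tau> t * (z' t \<bullet> z' t))"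
    using lyap_deriv(2)[OF t] C(1) by (rule mult_left_mono)
  then have "mom2' t + \<alpha>\<^sup>2 / (2 * \<delta>) * deriv lyap t \<le> - (\<delta> * (1 / \<tau> t) * mom2 t)"
    using mom2'_le[OF t] by linarith
  then have "\<eta>\<^sup>2 / k / \<delta> * (mom2' t + \<alpha>\<^sup>2 / (2 * \<delta>) * deriv lyap t)
      \<le> \<eta>\<^sup>2 / k / \<delta> * - (\<delta> * (1 / \<tau> t) * mom2 t)"
    using C(2) by (rule mult_left_mono)
  also have "\<dots> = - (\<eta>\<^sup>2 / k * (1 / \<tau> t * mom2 t))" using \<delta>_pos by simp
  finally have *: "\<eta>\<^sup>2 / k / \<delta> * (mom2' t + \<alpha>\<^sup>2 / (2 * \<delta>) * deriv lyap t)
      \<le> - (\<eta>\<^sup>2 / k * (1 / \<tau> t * mom2 t))" .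
  then show "kin' t + \<eta>\<^sup>2 / k / \<delta> * (mom2' t + \<alpha>\<^sup>2 / (2 * \<delta>) * deriv lyap t)
      \<le> - (k * (1 / \<tau> t) * kin t)"
    using kin'_le[OF t] by linarith
  have "0 \<le> \<eta>\<^sup>2 / k * (1 / \<tau> t * mom2 t)" using k_pos mom2_nonneg[of t] \<tau>_pos[OF t] by simp
  with * show "\<eta>\<^sup>2 / k / \<delta> * (mom2' t + \<alpha>\<^sup>2 / (2 * \<delta>) * deriv lyap t) \<le> 0" by linarith
  show "0 \<le> \<eta>\<^sup>2 / k / \<delta> * (mom2 t + \<alpha>\<^sup>2 / (2 * \<delta>) * lyap t)"
    using C lyap_nonneg[OF t] mom2_nonneg[of t] by (intro mult_nonneg_nonneg add_nonneg_nonneg)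
  show "(kin has_real_derivative kin' t) (at t)" "0 \<le> kin t"
    by (rule kin_deriv[OF t] kin_nonneg)+
  show "((\<lambda>t. \<eta>\<^sup>2 / k / \<delta> * (mom2 t + \<alpha>\<^sup>2 / (2 * \<delta>) * lyap t)) has_real_derivative
      \<eta>\<^sup>2 / k / \<delta> * (mom2' t + \<alpha>\<^sup>2 / (2 * \<delta>) * deriv lyap t)) (at t)"
    by (intro DERIV_cmult DERIV_add lyap_deriv mom2_deriv t)
  show "(S has_real_derivative 1 / \<tau> t) (at t)" by (rule S_deriv[OF t])
  show "0 \<le> 1 / \<tau> t" using \<tau>_pos[OF t] by simp
qed (fact S_top k_pos)+

section \<open>Limits of the operator, the gap and the distance to a zero\<close>

lemma half_inner_tendsto_zeroD:
  fixes u :: "real \<Rightarrow> 'c"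
  assumes "((\<lambda>t. (1/2) * (u t \<bullet> u t)) \<longlongrightarrow> 0) at_top"
  shows "(u \<longlongrightarrow> 0) at_top"
proof -
  have "((\<lambda>t. sqrt (2 * ((1/2) * (u t \<bullet> u t)))) \<longlongrightarrow> sqrt (2 * 0)) at_top"
    by (intro tendsto_intros assms)
  then show ?thesis by (simp add: norm_eq_sqrt_inner[symmetric] tendsto_norm_zero_iff)
qed

lemma velocity_tendsto: "((\<lambda>t. \<tau> t *\<^sub>R z' t) \<longlongrightarrow> 0) at_top"
  using kin_tendsto unfolding kin_def by (rule half_inner_tendsto_zeroD)

lemma operator_tendsto: "((\<lambda>t. B t *\<^sub>R v t) \<longlongrightarrow> 0) at_top"
proof -
  have "(momentum \<longlongrightarrow> 0) at_top"
    using mom2_tendsto unfolding mom2_def by (rule half_inner_tendsto_zeroD)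
  then have "((\<lambda>t. \<eta> *\<^sub>R (momentum t - \<tau> t *\<^sub>R z' t)) \<longlongrightarrow> \<eta> *\<^sub>R (0 - 0)) at_top"
    by (intro tendsto_intros velocity_tendsto)
  then show ?thesis using \<theta>_pos by (simp add: momentum_def)
qed

lemma eventually_bounded: "\<exists>K. \<forall>\<^sub>F t in at_top. norm (z t - zs) \<le> K"
  using bounded_orbit eventually_ge_at_top[of T] by (metis (mono_tags, lifting) eventually_mono)

lemma gap_tendsto: "((\<lambda>t. B t * ((z t - zs) \<bullet> v t)) \<longlongrightarrow> 0) at_top"
proof -
  obtain K where "\<forall>\<^sub>F t in at_top. norm (z t - zs) \<le> K" using eventually_bounded by blast
  from tendsto_inner_bounded_zero[OF this operator_tendsto] show ?thesis by simp
qed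

text \<open>\<open>lyap\<close> and \<open>\<kappa>\<close> converge, hence so does
  \<open>energy\<close>. Its kinetic, mixed and gap terms tend to zero, leaving the squared distance
  times \<open>\<eta> * (\<alpha> - \<tau>' t) / 2\<close>, a factor with nonzero limit.\<close>

lemma distance_converges: "\<exists>d. ((\<lambda>t. (norm (z t - zs))\<^sup>2) \<longlongrightarrow> d) at_top"
proof -
  obtain K where K: "\<forall>\<^sub>F t in at_top. norm (z t - zs) \<le> K" using eventually_bounded by blast
  obtain L where L: "(lyap \<longlongrightarrow> L) at_top"
    using antimono_bounded_below_converges[of T lyap 0] lyap_antimono lyap_nonneg by metis
  have "\<forall>\<^sub>F t in at_top. k \<le> \<alpha> - \<eta> - \<tau>' t"
    using eventually_ge_at_top[of T] by eventually_elim (rule k_le)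
  then have "k \<le> \<alpha> - \<eta> - l"
    by (intro tendsto_lowerbound[where f = "\<lambda>t. \<alpha> - \<eta> - \<tau>' t" and F = at_top] tendsto_intros \<tau>'_lim) auto
  \<comment> \<open>In the limit \<open>\<alpha> - l \<ge> \<eta> + k > 0\<close>.\<close>
  then have nz: "\<eta> * (\<alpha> - l) \<noteq> 0" using \<theta>_pos k_pos by (smt (verit) divide_pos_pos mult_eq_0_iff)
  have "((\<lambda>t. 2 * (lyap t * (\<alpha> - \<eta> - \<tau>' t) - B t * ((z t - zs) \<bullet> v t)
        - \<eta> * ((z t - zs) \<bullet> (\<tau> t *\<^sub>R z' t)) - kin t) / (\<eta> * (\<alpha> - \<tau>' t)))
      \<longlongrightarrow> 2 * (L * (\<alpha> - \<eta> - l) - 0 - \<eta> * 0 - 0) / (\<eta> * (\<alpha> - l))) at_top"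
    by (intro tendsto_intros L \<tau>'_lim gap_tendsto kin_tendsto
        tendsto_inner_bounded_zero[OF K velocity_tendsto] nz)
  moreover have "\<forall>\<^sub>F t in at_top. 2 * (lyap t * (\<alpha> - \<eta> - \<tau>' t) - B t * ((z t - zs) \<bullet> v t)
        - \<eta> * ((z t - zs) \<bullet> (\<tau> t *\<^sub>R z' t)) - kin t) / (\<eta> * (\<alpha> - \<tau>' t)) = (norm (z t - zs))\<^sup>2"
    using eventually_ge_at_top[of T]
  proof eventually_elim
    case (elim t)
    define y where "y = z t - zs"
    have pos: "\<alpha> - \<tau>' t > 0" using k_le[OF elim] k_pos \<theta>_pos by (smt (verit) divide_pos_pos)
    have "lyap t * (\<alpha> - \<eta> - \<tau>' t) = energy t"
      using \<kappa>_pos[OF elim] by (simp add: lyap_def \<kappa>_def)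
    moreover have "energy t = \<eta>\<^sup>2 / 2 * (y \<bullet> y) + \<eta> * (y \<bullet> (\<tau> t *\<^sub>R z' t)) + kin t
        + B t * (y \<bullet> v t) + \<eta> / 2 * (\<alpha> - \<eta> - \<tau>' t) * (y \<bullet> y)"
      unfolding energy_def kin_def \<kappa>_def y_def[symmetric]
      by (simp add: inner_add_left inner_add_right inner_commute power2_eq_square algebra_simps)
    moreover have "\<eta>\<^sup>2 / 2 * (y \<bullet> y) + \<eta> / 2 * (\<alpha> - \<eta> - \<tau>' t) * (y \<bullet> y)
        = (\<eta> * (\<alpha> - \<tau>' t) * (norm y)\<^sup>2) / 2"
      unfolding power2_norm_eq_inner using \<theta>_pos by (simp add: power2_eq_square field_simps)
    moreover have "e = E \<Longrightarrow> E = p + m + n + g + q \<Longrightarrow> p + q = s / 2 \<Longrightarrow> 2 * (e - g - m - n) = s"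
      for e E p m n g q s :: real by (simp add: field_simps)
    ultimately have "2 * (lyap t * (\<alpha> - \<eta> - \<tau>' t) - B t * (y \<bullet> v t)
        - \<eta> * (y \<bullet> (\<tau> t *\<^sub>R z' t)) - kin t) = \<eta> * (\<alpha> - \<tau>' t) * (norm y)\<^sup>2"
      by blast
    then show ?case unfolding y_def[symmetric] using pos \<theta>_pos by simp
  qed
  ultimately have "((\<lambda>t. (norm (z t - zs))\<^sup>2) \<longlongrightarrow>
      2 * (L * (\<alpha> - \<eta> - l) - 0 - \<eta> * 0 - 0) / (\<eta> * (\<alpha> - l))) at_top"
    by (rule Lim_transform_eventually)
  then show ?thesis by blast
qed

end

section \<open>The primal-dual system\<close>

lemma powr_at_top:
  fixes s :: real
  assumes "s > 0"
  shows "filterlim (\<lambda>t :: real. t powr s) at_top at_top"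
proof -
  have "filterlim (\<lambda>t. exp (s * ln t)) at_top at_top"
    by (intro filterlim_compose[OF exp_at_top] filterlim_tendsto_pos_mult_at_top[OF tendsto_const assms]
        ln_at_top)
  moreover have "\<forall>\<^sub>F t :: real in at_top. exp (s * ln t) = t powr s"
    using eventually_gt_at_top[of 0] by eventually_elim (simp add: powr_def)
  ultimately show ?thesis by (rule filterlim_cong[THEN iffD1, OF refl refl, rotated])
qed

lemma powr_double: "t powr (2 * s) = (t powr s)\<^sup>2"
  for t s :: real
  by (simp add: power2_eq_square powr_add[symmetric])

text \<open>For \<open>t \<ge> 1\<close> a smaller exponent gives a smaller weight, so a limit at
  the exponent \<open>a'\<close> yields every rate with \<open>a \<le> a'\<close>. This reduces all
  rates to \<open>\<rho> = r\<close>.\<close>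

lemma smallo_inverse_powrI:
  fixes h g :: "real \<Rightarrow> real"
  assumes lim: "((\<lambda>t. t powr a' * g t * h t) \<longlongrightarrow> 0) at_top" and "a \<le> a'"
    and pos: "\<forall>\<^sub>F t in at_top. 0 < g t"
  shows "h \<in> o[at_top](\<lambda>t. 1 / (t powr a * g t))"
proof (rule smalloI_tendsto)
  show "\<forall>\<^sub>F t in at_top. 1 / (t powr a * g t) \<noteq> 0"
    using pos eventually_gt_at_top[of 0] by eventually_elim simp
  have "((\<lambda>t. t powr a * g t * h t) \<longlongrightarrow> 0) at_top"
  proof (rule Lim_null_comparison)
    show "((\<lambda>t. \<bar>t powr a' * g t * h t\<bar>) \<longlongrightarrow> 0) at_top" using lim by (rule tendsto_rabs_zero)
    show "\<forall>\<^sub>F t in at_top. norm (t powr a * g t * h t) \<le> \<bar>t powr a' * g t * h t\<bar>"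
      using pos eventually_ge_at_top[of 1]
    proof eventually_elim
      case (elim t)
      then have "t powr a \<le> t powr a'" using \<open>a \<le> a'\<close> by (intro powr_mono) auto
      then show ?case using elim by (auto simp: abs_mult intro!: mult_right_mono)
    qed
  qed
  then show "((\<lambda>t. h t / (1 / (t powr a * g t))) \<longlongrightarrow> 0) at_top" by (simp add: mult_ac)
qed

text \<open>\<open>damping\<close> unites the two parameter regimes: \<open>\<kappa>\<close> must
  stay positive at infinity, where the derivative of \<open>t powr r\<close> tends to 1 if
  \<open>r = 1\<close> and to 0 otherwise. \<open>growth\<close> is the supremum condition with an
  explicit constant.\<close>

locale primal_dual_flow =
  fixes f :: "'a::{real_inner, complete_space} \<Rightarrow> real"
    and Df :: "'a \<Rightarrow> 'a"
    and A :: "'a \<Rightarrow> 'b::{real_inner, complete_space}"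
    and b :: 'b
    and t\<^sub>0 r \<alpha> \<theta> :: real
    and \<beta> \<beta>' :: "real \<Rightarrow> real"
    and x x' x'' G' :: "real \<Rightarrow> 'a"
    and lam lam' lam'' :: "real \<Rightarrow> 'b"
  assumes A: "bounded_linear A"
    and conv: "convex_on UNIV f"
    and grad: "\<And>y. GDERIV f y :> Df y"
    and Df_cont: "continuous_on UNIV Df"
    and t\<^sub>0: "t\<^sub>0 > 0" and r: "0 \<le> r" "r \<le> 1" and \<theta>: "\<theta> > 0"
    and damping: "1 / \<theta> + (if r = 1 then 1 else 0) < \<alpha>"
    and \<beta>_pos: "\<And>t. t \<ge> t\<^sub>0 \<Longrightarrow> \<beta> t > 0"
    and \<beta>_deriv: "\<And>t. t \<ge> t\<^sub>0 \<Longrightarrow> (\<beta> has_real_derivative \<beta>' t) (at t within {t\<^sub>0..})"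
    and \<beta>_mono: "mono_on {t\<^sub>0..} \<beta>"
    and growth: "\<exists>c<1 / \<theta>. \<forall>t\<ge>t\<^sub>0. t powr r * (\<beta>' t / \<beta> t + 2 * r / t) \<le> c"
    and trajectory: "primal_dual_trajectory Df A b t\<^sub>0 r \<alpha> \<theta> \<beta> x x' x'' G' lam lam' lam''"
begin

text \<open>The saddle operator of the Lagrangian: its gradient in the primal variable, and minus
  its gradient in the dual one. The sign makes the linear part skew.\<close>

definition KKT :: "'a \<times> 'b \<Rightarrow> 'a \<times> 'b" where
  "KKT p = (Df (fst p) + adjoint A (snd p), b - A (fst p))"

abbreviation z :: "real \<Rightarrow> 'a \<times> 'b" where "z t \<equiv> (x t, lam t)"
abbreviation z' :: "real \<Rightarrow> 'a \<times> 'b" where "z' t \<equiv> (x' t, lam' t)"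

lemma KKT_eq_0_iff: "KKT (p, q) = 0 \<longleftrightarrow> primal_dual_solution Df A b p q"
  by (auto simp: KKT_def primal_dual_solution_def zero_prod_def)

text \<open>The contributions of \<open>A\<close> and \<open>adjoint A\<close> cancel by skewness,
  so only the gradient of \<open>f\<close> is left.\<close>

lemma KKT_inner: "(KKT p - KKT q) \<bullet> (p - q) = (Df (fst p) - Df (fst q)) \<bullet> (fst p - fst q)"
proof -
  interpret A: bounded_linear A by (rule A)
  interpret A': bounded_linear "adjoint A" using A by (rule bounded_linear_adjoint)
  have "adjoint A (snd p - snd q) \<bullet> (fst p - fst q) = A (fst p - fst q) \<bullet> (snd p - snd q)"
    by (metis adjoint_inner[OF A] inner_commute)
  then show ?thesis
    by (simp add: KKT_def inner_prod_def A.diff A'.diff inner_diff_left inner_diff_right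
        inner_add_left inner_add_right inner_commute)
qed

lemma KKT_monotone: "0 \<le> (KKT p - KKT q) \<bullet> (p - q)"
  unfolding KKT_inner by (rule convex_gradient_monotone[OF conv grad])

lemma KKT_continuous: "continuous_on UNIV KKT"
  unfolding KKT_def
  by (intro continuous_intros continuous_on_compose2[OF Df_cont]
      bounded_linear.continuous_on[OF A] bounded_linear.continuous_on[OF bounded_linear_adjoint[OF A]]) auto

text \<open>The abstract flow starts at a late time \<open>T\<close>: beyond
  \<open>t\<^sub>0\<close> derivatives are two-sided, and far enough out the derivative of
  \<open>t powr r\<close> is near its limit \<open>l\<close>, as the bound by \<open>k\<close>
  demands.\<close>

lemma monotone_flow_ex:
  "\<exists>T B' S c k l. t\<^sub>0 < T \<and> (\<forall>zs. KKT zs = 0 \<longrightarrow> monotone_flow z z' (\<lambda>t. (x'' t, lam'' t)) (\<lambda>t. KKT (z t))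
     (\<lambda>t. (G' t + adjoint A (lam' t), - A (x' t)))
     (\<lambda>t. t powr r) (\<lambda>t. r * t powr (r - 1)) (\<lambda>t. r * ((r - 1) * t powr (r - 1 - 1)))
     (\<lambda>t. t powr (2 * r) * \<beta> t) B' S T \<alpha> \<theta> c k l zs)"
proof -
  interpret A: bounded_linear A by (rule A)
  interpret A': bounded_linear "adjoint A" using A by (rule bounded_linear_adjoint)
  define l :: real where "l = (if r = 1 then 1 else 0)"
  \<comment> \<open>Half of the limiting value of \<open>\<kappa>\<close>; the other half is the
    margin for reaching the limit.\<close>
  define k where "k = (\<alpha> - 1 / \<theta> - l) / 2"
  obtain c where c: "c < 1 / \<theta>" "\<And>t. t \<ge> t\<^sub>0 \<Longrightarrow> t powr r * (\<beta>' t / \<beta> t + 2 * r / t) \<le> c"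
    using growth by blast
  \<comment> \<open>Written through the logarithmic derivative, so that \<open>B'_le\<close> becomes
    the growth hypothesis verbatim.\<close>
  define B' where "B' t = t powr (2 * r) * \<beta> t * (\<beta>' t / \<beta> t + 2 * r / t)" for t
  define S where "S t = (if r = 1 then ln t else t powr (1 - r) / (1 - r))" for t
  have k_pos: "k > 0" using damping by (simp add: k_def l_def)
  have lim: "((\<lambda>t. r * t powr (r - 1)) \<longlongrightarrow> l) at_top"
  proof (cases "r = 1")
    case True
    have "\<forall>\<^sub>F t in at_top. 1 = r * t powr (r - 1)"
      using eventually_gt_at_top[of 0] by eventually_elim (simp add: True)
    then show ?thesis using tendsto_const[of 1] by (simp add: l_def True tendsto_eventually eventually_mono)
  next
    case False
    then have "((\<lambda>t. r * t powr (r - 1)) \<longlongrightarrow> r * 0) at_top"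
      using r by (intro tendsto_mult tendsto_const tendsto_neg_powr filterlim_ident) auto
    then show ?thesis using False by (simp add: l_def)
  qed
  have "l < \<alpha> - 1 / \<theta> - k" using k_pos unfolding k_def by (simp add: field_simps)
  then have "\<forall>\<^sub>F t in at_top. r * t powr (r - 1) < \<alpha> - 1 / \<theta> - k"
    using lim by (simp add: order_tendsto_iff)
  then obtain T1 where T1: "\<And>t. T1 \<le> t \<Longrightarrow> r * t powr (r - 1) < \<alpha> - 1 / \<theta> - k"
    unfolding eventually_at_top_linorder by blast
  define T where "T = max T1 (t\<^sub>0 + 1)"
  have T: "t\<^sub>0 < T" "T1 \<le> T" by (simp_all add: T_def)
  have S_top: "filterlim S at_top at_top"
  proof (cases "r = 1")
    case True
    then have "S = ln" by (simp add: S_def fun_eq_iff)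
    then show ?thesis using ln_at_top by simp
  next
    case False
    then have "filterlim (\<lambda>t :: real. t powr (1 - r) * (1 / (1 - r))) at_top at_top"
      using r by (intro filterlim_at_top_mult_tendsto_pos[OF tendsto_const] powr_at_top) auto
    moreover have "S = (\<lambda>t. t powr (1 - r) * (1 / (1 - r)))" using False by (simp add: S_def fun_eq_iff)
    ultimately show ?thesis by simp
  qed
  have "monotone_flow z z' (\<lambda>t. (x'' t, lam'' t)) (\<lambda>t. KKT (z t))
     (\<lambda>t. (G' t + adjoint A (lam' t), - A (x' t)))
     (\<lambda>t. t powr r) (\<lambda>t. r * t powr (r - 1)) (\<lambda>t. r * ((r - 1) * t powr (r - 1 - 1)))
     (\<lambda>t. t powr (2 * r) * \<beta> t) B' S T \<alpha> \<theta> c k l zs" if zs: "KKT zs = 0" for zs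
  proof
    fix t assume "T \<le> t"
    then have t: "t\<^sub>0 < t" "t\<^sub>0 \<le> t" "0 < t" "T1 \<le> t" using T t\<^sub>0 by auto
    have at: "at t within {t\<^sub>0..} = at t" using t by (intro at_within_interior) simp
    have \<beta>t: "\<beta> t > 0" using \<beta>_pos t by simp
    have traj: "(x has_vector_derivative x' t) (at t)" "(x' has_vector_derivative x'' t) (at t)"
      "((\<lambda>s. Df (x s)) has_vector_derivative G' t) (at t)"
      "(lam has_vector_derivative lam' t) (at t)" "(lam' has_vector_derivative lam'' t) (at t)"
      "x'' t + (\<alpha> / t powr r) *\<^sub>R x' t + (\<theta> * t powr r * \<beta> t) *\<^sub>R G' t
          + \<beta> t *\<^sub>R adjoint A (lam t + (\<theta> * t powr r) *\<^sub>R lam' t) + \<beta> t *\<^sub>R Df (x t) = 0"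
      "lam'' t + (\<alpha> / t powr r) *\<^sub>R lam' t
          - \<beta> t *\<^sub>R (A (x t + (\<theta> * t powr r) *\<^sub>R x' t) - b) = 0"
      using trajectory t unfolding primal_dual_trajectory_def at[symmetric] by auto
    show zd: "(z has_vector_derivative z' t) (at t)"
      and "(z' has_vector_derivative (x'' t, lam'' t)) (at t)"
      by (intro has_vector_derivative_Pair traj)+
    show vd: "((\<lambda>t. KKT (z t)) has_vector_derivative (G' t + adjoint A (lam' t), - A (x' t))) (at t)"
    proof -
      have "((\<lambda>t. b - A (x t)) has_vector_derivative 0 - A (x' t)) (at t)"
        by (intro has_vector_derivative_diff has_vector_derivative_const A.has_vector_derivative traj)
      moreover have "((\<lambda>t. Df (x t) + adjoint A (lam t)) has_vector_derivative
          G' t + adjoint A (lam' t)) (at t)"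
        by (intro has_vector_derivative_add A'.has_vector_derivative traj)
      ultimately show ?thesis unfolding KKT_def by (auto dest: has_vector_derivative_Pair)
    qed
    have \<tau>: "t powr r > 0" using t by simp
    have BB: "t powr (2 * r) = t powr r * t powr r" by (simp add: powr_double power2_eq_square)
    show "t powr r *\<^sub>R (x'' t, lam'' t) + \<alpha> *\<^sub>R z' t
        + (\<theta> * (t powr (2 * r) * \<beta> t)) *\<^sub>R (G' t + adjoint A (lam' t), - A (x' t))
        + (t powr (2 * r) * \<beta> t / t powr r) *\<^sub>R KKT (z t) = 0"
    proof -
      have "t powr r *\<^sub>R x'' t + \<alpha> *\<^sub>R x' t + (\<theta> * (t powr (2 * r) * \<beta> t)) *\<^sub>R (G' t + adjoint A (lam' t))
          + (t powr (2 * r) * \<beta> t / t powr r) *\<^sub>R (Df (x t) + adjoint A (lam t))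
          = t powr r *\<^sub>R (x'' t + (\<alpha> / t powr r) *\<^sub>R x' t + (\<theta> * t powr r * \<beta> t) *\<^sub>R G' t
          + \<beta> t *\<^sub>R adjoint A (lam t + (\<theta> * t powr r) *\<^sub>R lam' t) + \<beta> t *\<^sub>R Df (x t))"
        unfolding BB using \<tau> by (simp add: A'.add A'.scale scaleR_add_right mult_ac add_ac)
      moreover have "t powr r *\<^sub>R lam'' t + \<alpha> *\<^sub>R lam' t + (\<theta> * (t powr (2 * r) * \<beta> t)) *\<^sub>R (- A (x' t))
          + (t powr (2 * r) * \<beta> t / t powr r) *\<^sub>R (b - A (x t))
          = t powr r *\<^sub>R (lam'' t + (\<alpha> / t powr r) *\<^sub>R lam' t
          - \<beta> t *\<^sub>R (A (x t + (\<theta> * t powr r) *\<^sub>R x' t) - b))"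
        unfolding BB using \<tau> by (simp add: A.add A.scale scaleR_add_right scaleR_diff_right mult_ac add_ac)
      ultimately show ?thesis unfolding traj KKT_def by (simp add: zero_prod_def)
    qed
    \<comment> \<open>Difference quotients are used because \<open>Df\<close> is assumed only
      continuous.\<close>
    show "0 \<le> z' t \<bullet> (G' t + adjoint A (lam' t), - A (x' t))"
      by (rule monotone_along_curve[OF zd[folded at] vd[folded at] t(2)])
         (metis KKT_monotone inner_commute)
    show "0 \<le> (z t - zs) \<bullet> KKT (z t)"
      using KKT_monotone[of "z t" zs] zs by (simp add: inner_commute)
    show "0 < t powr r" by fact
    show "((\<lambda>t. t powr r) has_real_derivative r * t powr (r - 1)) (at t)"
      using t by (intro has_real_derivative_powr)
    show "((\<lambda>t. r * t powr (r - 1)) has_real_derivative r * ((r - 1) * t powr (r - 1 - 1))) (at t)"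
      using t by (intro DERIV_cmult has_real_derivative_powr)
    show "0 \<le> r * t powr (r - 1)" using r by simp
    show "r * ((r - 1) * t powr (r - 1 - 1)) \<le> 0" using r
      by (intro mult_nonneg_nonpos mult_nonpos_nonneg) auto
    show "0 < t powr (2 * r) * \<beta> t" using t \<beta>t by simp
    have \<beta>d: "(\<beta> has_real_derivative \<beta>' t) (at t)" using \<beta>_deriv[of t] t at by simp
    show "((\<lambda>t. t powr (2 * r) * \<beta> t) has_real_derivative B' t) (at t)"
      by (rule DERIV_cong[OF DERIV_mult[OF has_real_derivative_powr[OF t(3)] \<beta>d]])
         (use t \<beta>t in \<open>simp add: B'_def powr_diff field_simps\<close>)
    have "0 \<le> \<beta>' t" using mono_on_imp_deriv_nonneg[OF \<beta>_mono \<beta>d] t by simp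
    then show "0 \<le> B' t" using t r \<beta>t by (simp add: B'_def)
    show "B' t * t powr r \<le> c * (t powr (2 * r) * \<beta> t)"
    proof -
      have "B' t * t powr r = t powr (2 * r) * \<beta> t * (t powr r * (\<beta>' t / \<beta> t + 2 * r / t))"
        by (simp add: B'_def)
      also have "\<dots> \<le> t powr (2 * r) * \<beta> t * c" using c(2)[OF t(2)] \<beta>t by (intro mult_left_mono) auto
      finally show ?thesis by (simp add: mult_ac)
    qed
    show "k \<le> \<alpha> - 1 / \<theta> - r * t powr (r - 1)" using T1[OF t(4)] by linarith
    show "(S has_real_derivative 1 / t powr r) (at t)"
    proof (cases "r = 1")
      case True
      then show ?thesis using DERIV_ln_divide[OF t(3)] t by (simp add: S_def[abs_def])
    next
      case False
      have "((\<lambda>t. t powr (1 - r) / (1 - r)) has_real_derivative (1 - r) * t powr (1 - r - 1) / (1 - r)) (at t)"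
        using t by (intro DERIV_cdivide has_real_derivative_powr)
      then show ?thesis using False t by (simp add: S_def[abs_def] powr_minus_divide)
    qed
  qed (fact lim c(1) \<theta> k_pos S_top)+
  then show ?thesis using T(1) by blast
qed

section \<open>Asymptotics of the primal-dual orbit\<close>

lemma
  assumes zs: "KKT zs = 0"
  shows bounded_orbit: "bounded (z ` {t\<^sub>0..})"
    and velocity_tendsto: "((\<lambda>t. t powr r *\<^sub>R z' t) \<longlongrightarrow> 0) at_top"
    and KKT_tendsto: "((\<lambda>t. (t powr (2 * r) * \<beta> t) *\<^sub>R KKT (z t)) \<longlongrightarrow> 0) at_top"
    and gap_tendsto: "((\<lambda>t. t powr (2 * r) * \<beta> t * ((z t - zs) \<bullet> KKT (z t))) \<longlongrightarrow> 0) at_top"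
    and distance_converges: "\<exists>d. ((\<lambda>t. (norm (z t - zs))\<^sup>2) \<longlongrightarrow> d) at_top"
proof -
  obtain T B' S c k l where T: "t\<^sub>0 < T" and flow: "monotone_flow z z' (\<lambda>t. (x'' t, lam'' t)) (\<lambda>t. KKT (z t))
     (\<lambda>t. (G' t + adjoint A (lam' t), - A (x' t)))
     (\<lambda>t. t powr r) (\<lambda>t. r * t powr (r - 1)) (\<lambda>t. r * ((r - 1) * t powr (r - 1 - 1)))
     (\<lambda>t. t powr (2 * r) * \<beta> t) B' S T \<alpha> \<theta> c k l zs"
    using monotone_flow_ex zs by blast
  show "((\<lambda>t. t powr r *\<^sub>R z' t) \<longlongrightarrow> 0) at_top" by (rule monotone_flow.velocity_tendsto[OF flow])
  show "((\<lambda>t. (t powr (2 * r) * \<beta> t) *\<^sub>R KKT (z t)) \<longlongrightarrow> 0) at_top"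
    by (rule monotone_flow.operator_tendsto[OF flow])
  show "((\<lambda>t. t powr (2 * r) * \<beta> t * ((z t - zs) \<bullet> KKT (z t))) \<longlongrightarrow> 0) at_top"
    by (rule monotone_flow.gap_tendsto[OF flow])
  show "\<exists>d. ((\<lambda>t. (norm (z t - zs))\<^sup>2) \<longlongrightarrow> d) at_top"
    by (rule monotone_flow.distance_converges[OF flow])
  obtain K where "\<And>t. T \<le> t \<Longrightarrow> norm (z t - zs) \<le> K"
    using monotone_flow.bounded_orbit[OF flow] by blast
  then have "z ` {T..} \<subseteq> cball zs K" by (auto simp: dist_norm norm_minus_commute)
  then have "bounded (z ` {T..})" using bounded_cball bounded_subset by blast
  \<comment> \<open>The flow estimates start at \<open>T\<close>; the initial piece is bounded as a
    continuous image of a compact interval.\<close>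
  moreover have "bounded (z ` {t\<^sub>0..T})"
  proof (intro compact_imp_bounded compact_continuous_image compact_Icc)
    have "(z has_vector_derivative z' t) (at t within {t\<^sub>0..})" if "t\<^sub>0 \<le> t" for t
      using trajectory that unfolding primal_dual_trajectory_def by (intro has_vector_derivative_Pair) auto
    then have "continuous_on {t\<^sub>0..} z"
      by (meson atLeast_iff continuous_on_eq_continuous_within has_vector_derivative_continuous)
    then show "continuous_on {t\<^sub>0..T} z" by (rule continuous_on_subset) auto
  qed
  ultimately have "bounded (z ` {T..} \<union> z ` {t\<^sub>0..T})" by simp
  moreover have "z ` {t\<^sub>0..} \<subseteq> z ` {T..} \<union> z ` {t\<^sub>0..T}" by (auto simp: image_iff) (metis atLeastAtMost_iff atLeast_iff linear)
  ultimately show "bounded (z ` {t\<^sub>0..})" by (rule bounded_subset)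
qed

text \<open>As \<open>\<beta>\<close> is nondecreasing and powers of \<open>t \<ge> 1\<close> are at
  least 1, the weights cannot degenerate. Hence weighted limits imply unweighted ones, and the
  weight \<open>B\<close> dominates its square root up to a constant.\<close>

lemma scale_lower_bound: "\<exists>m>0. \<forall>\<^sub>F t in at_top. m \<le> t powr r * sqrt (\<beta> t) \<and> m \<le> t powr (2 * r) * \<beta> t"
proof (intro exI conjI)
  define m where "m = min (sqrt (\<beta> t\<^sub>0)) (\<beta> t\<^sub>0)"
  show "m > 0" using \<beta>_pos[of t\<^sub>0] by (simp add: m_def)
  show "\<forall>\<^sub>F t in at_top. m \<le> t powr r * sqrt (\<beta> t) \<and> m \<le> t powr (2 * r) * \<beta> t"
    using eventually_ge_at_top[of "max t\<^sub>0 1"]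
  proof eventually_elim
    case (elim t)
    then have "\<beta> t\<^sub>0 \<le> \<beta> t" using \<beta>_mono by (auto simp: mono_on_def)
    moreover have "1 \<le> t powr r" "1 \<le> t powr (2 * r)" using elim r by (auto intro: ge_one_powr_ge_zero)
    ultimately have "1 * sqrt (\<beta> t\<^sub>0) \<le> t powr r * sqrt (\<beta> t)" "1 * \<beta> t\<^sub>0 \<le> t powr (2 * r) * \<beta> t"
      using \<beta>_pos[of t\<^sub>0] by (intro mult_mono; simp)+
    then show ?case by (auto simp: m_def min_le_iff_disj)
  qed
qed

lemma KKT_tendsto_0:
  assumes "KKT zs = 0"
  shows "((\<lambda>t. KKT (z t)) \<longlongrightarrow> 0) at_top"
proof -
  obtain m where "m > 0" and ev: "\<forall>\<^sub>F t in at_top. m \<le> t powr r * sqrt (\<beta> t) \<and> m \<le> t powr (2 * r) * \<beta> t"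
    using scale_lower_bound by blast
  show ?thesis
  proof (rule Lim_null_comparison)
    show "((\<lambda>t. norm ((t powr (2 * r) * \<beta> t) *\<^sub>R KKT (z t)) / m) \<longlongrightarrow> 0) at_top"
      using tendsto_divide[OF tendsto_norm_zero[OF KKT_tendsto[OF assms]] tendsto_const[of m]] \<open>m > 0\<close> by simp
    show "\<forall>\<^sub>F t in at_top. norm (KKT (z t)) \<le> norm ((t powr (2 * r) * \<beta> t) *\<^sub>R KKT (z t)) / m"
      using ev
    proof eventually_elim
      case (elim t)
      have "m * norm (KKT (z t)) \<le> \<bar>t powr (2 * r) * \<beta> t\<bar> * norm (KKT (z t))"
        using elim by (intro mult_right_mono) auto
      then show ?case using \<open>m > 0\<close> by (simp add: pos_le_divide_eq mult.commute)
    qed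
  qed
qed

text \<open>Opial's lemma for the zero set of \<open>KKT\<close>: distances converge to every zero,
  not only to \<open>zs\<close>, and Minty's argument identifies the cluster points since
  \<open>KKT (z t)\<close> tends strongly to zero.\<close>

lemma weak_convergence:
  assumes "KKT zs = 0"
  obtains w where "KKT w = 0" "weakly_tendsto z w at_top"
proof -
  obtain K where K: "\<And>t. t\<^sub>0 \<le> t \<Longrightarrow> norm (z t) \<le> K"
    using bounded_orbit[OF assms] unfolding bounded_iff by auto
  then have bdd: "\<forall>\<^sub>F t in at_top. norm (z t) \<le> K"
    by (rule eventually_mono[OF eventually_ge_at_top[of t\<^sub>0]])
  obtain w where w: "w \<in> {p. KKT p = 0}" "\<And>v. ((\<lambda>t. z t \<bullet> v) \<longlongrightarrow> w \<bullet> v) at_top"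
  proof (rule opial[OF trivial_limit_at_top_linorder bdd, of "{p. KKT p = 0}"])
    show "\<exists>d. ((\<lambda>t. (norm (z t - p))\<^sup>2) \<longlongrightarrow> d) at_top" if "p \<in> {p. KKT p = 0}" for p
      using distance_converges that by simp
    show "y \<in> {p. KKT p = 0}"
      if "F \<le> at_top" "F \<noteq> bot" "\<And>v. ((\<lambda>t. z t \<bullet> v) \<longlongrightarrow> y \<bullet> v) F" for F y
      using monotone_weak_strong_closed[OF KKT_monotone KKT_continuous that(2)
          filter_leD[OF that(1) bdd] that(3) tendsto_mono[OF that(1) KKT_tendsto_0[OF assms]]] by simp
  qed blast
  have "weakly_tendsto z w at_top"
    unfolding weakly_tendsto_def
  proof (intro allI impI)
    fix \<phi> :: "'a \<times> 'b \<Rightarrow> real" assume "bounded_linear \<phi>"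
    then obtain v where "\<And>p. \<phi> p = p \<bullet> v" using riesz_representation by blast
    then show "((\<lambda>t. \<phi> (z t)) \<longlongrightarrow> \<phi> w) at_top" using w(2)[of v] by simp
  qed
  with w(1) show ?thesis using that by simp
qed

text \<open>All rates come from limits at weight \<open>B\<close> for \<open>KKT\<close> and the
  gap, and at weight \<open>t powr r\<close> for the velocity; the Lagrangian gap is a Bregman
  distance of \<open>f\<close>.\<close>

lemma rates:
  assumes sol: "primal_dual_solution Df A b xs lams" and \<rho>: "\<rho> \<le> r"
  shows "convergence_rates f Df A b r \<beta> x x' lam lam' xs lams \<rho>"
proof -
  interpret A: bounded_linear A by (rule A)
  interpret A': bounded_linear "adjoint A" using A by (rule bounded_linear_adjoint)
  have zs: "KKT (xs, lams) = 0" using sol by (simp add: KKT_eq_0_iff)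
  have Dxs: "Df xs = - adjoint A lams" and Axs: "A xs = b"
    using sol by (auto simp: primal_dual_solution_def eq_neg_iff_add_eq_0)
  define B where "B t = t powr (2 * r) * \<beta> t" for t
  define gap where "gap t = lagrangian f A b (x t) lams - lagrangian f A b xs (lam t)" for t
  \<comment> \<open>Feasibility of \<open>xs\<close> removes \<open>lam t\<close>, and stationarity
    turns the constraint term into the linear part of the Bregman distance.\<close>
  have gap_eq: "gap t = f (x t) - f xs - Df xs \<bullet> (x t - xs)" for t
  proof -
    have "lams \<bullet> (A (x t) - b) = A (x t - xs) \<bullet> lams"
      by (metis A.diff Axs inner_commute)
    also have "\<dots> = - (Df xs \<bullet> (x t - xs))" by (metis adjoint_inner[OF A] Dxs inner_commute inner_minus_left minus_minus)
    finally show ?thesis by (simp add: gap_def lagrangian_def Axs)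
  qed
  have gap_nonneg: "0 \<le> gap t" for t
    using convex_gradient_inequality[OF conv grad, of xs "x t"] by (simp add: gap_eq)
  \<comment> \<open>The gradient inequality based at \<open>x t\<close> bounds the Bregman distance
    by its symmetrised form, which is the gap of the flow.\<close>
  have gap_le: "gap t \<le> (z t - (xs, lams)) \<bullet> KKT (z t)" for t
  proof -
    have "gap t \<le> (Df (x t) - Df xs) \<bullet> (x t - xs)"
      using convex_gradient_inequality[OF conv grad, of "x t" xs]
      by (simp add: gap_eq inner_diff_left inner_diff_right)
    also have "\<dots> = (z t - (xs, lams)) \<bullet> KKT (z t)"
      using KKT_inner[of "z t" "(xs, lams)"] zs by (simp add: inner_commute)
    finally show ?thesis .
  qed
  have \<beta>_ev: "\<forall>\<^sub>F t in at_top. 0 < \<beta> t" using eventually_ge_at_top[of t\<^sub>0] by eventually_elim (rule \<beta>_pos)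
  have B_ev: "\<forall>\<^sub>F t in at_top. 0 < B t"
    using \<beta>_ev eventually_gt_at_top[of 0] by eventually_elim (simp add: B_def)
  have gap_lim: "((\<lambda>t. B t * gap t) \<longlongrightarrow> 0) at_top"
  proof (rule Lim_null_comparison[OF _ gap_tendsto[OF zs]])
    show "\<forall>\<^sub>F t in at_top. norm (B t * gap t)
        \<le> t powr (2 * r) * \<beta> t * ((z t - (xs, lams)) \<bullet> KKT (z t))"
      using B_ev
    proof eventually_elim
      case (elim t)
      then show ?case using gap_nonneg[of t] gap_le[of t] unfolding B_def[symmetric] by simp
    qed
  qed
  have KKT1: "((\<lambda>t. B t *\<^sub>R (Df (x t) + adjoint A (lam t))) \<longlongrightarrow> 0) at_top"
    using tendsto_fst[OF KKT_tendsto[OF zs]] by (simp add: KKT_def B_def)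
  have "((\<lambda>t. B t *\<^sub>R (b - A (x t))) \<longlongrightarrow> 0) at_top"
    using tendsto_snd[OF KKT_tendsto[OF zs]] by (simp add: KKT_def B_def)
  then have "((\<lambda>t. \<bar>B t\<bar> * norm (A (x t) - b)) \<longlongrightarrow> 0) at_top"
    using tendsto_norm_zero by (fastforce simp: norm_minus_commute)
  then have feas_lim: "((\<lambda>t. B t * norm (A (x t) - b)) \<longlongrightarrow> 0) at_top"
    using tendsto_rabs_zero_cancel[of "\<lambda>t. B t * norm (A (x t) - b)"] by (simp add: abs_mult)
  have f_lim: "((\<lambda>t. B t * \<bar>f (x t) - f xs\<bar>) \<longlongrightarrow> 0) at_top"
  proof (rule Lim_null_comparison)
    show "((\<lambda>t. B t * gap t + norm lams * (B t * norm (A (x t) - b))) \<longlongrightarrow> 0) at_top"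
      using tendsto_add[OF gap_lim tendsto_mult_right_zero[OF feas_lim]] by simp
    show "\<forall>\<^sub>F t in at_top. norm (B t * \<bar>f (x t) - f xs\<bar>)
        \<le> B t * gap t + norm lams * (B t * norm (A (x t) - b))"
      using B_ev
    proof eventually_elim
      case (elim t)
      have "f (x t) - f xs = gap t - lams \<bullet> (A (x t) - b)" by (simp add: gap_def lagrangian_def Axs)
      then have "\<bar>f (x t) - f xs\<bar> \<le> gap t + norm lams * norm (A (x t) - b)"
        using gap_nonneg[of t] Cauchy_Schwarz_ineq2[of lams "A (x t) - b"] by linarith
      then have "B t * \<bar>f (x t) - f xs\<bar> \<le> B t * (gap t + norm lams * norm (A (x t) - b))"
        using elim by (intro mult_left_mono) auto
      then show ?case using elim by (simp add: algebra_simps abs_mult)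
    qed
  qed
  have x'_lim: "((\<lambda>t. t powr r * norm (x' t)) \<longlongrightarrow> 0) at_top"
    using tendsto_norm_zero[OF tendsto_fst[OF velocity_tendsto[OF zs], simplified]] by simp
  have lam'_lim: "((\<lambda>t. t powr r * norm (lam' t)) \<longlongrightarrow> 0) at_top"
    using tendsto_norm_zero[OF tendsto_snd[OF velocity_tendsto[OF zs], simplified]] by simp
  \<comment> \<open>The squared gradient difference is at most \<open>4 * L\<close> times the
    Bregman distance, and the square of the weight is \<open>B\<close>.\<close>
  have Df_lim: "((\<lambda>t. t powr r * sqrt (\<beta> t) * norm (Df (x t) - Df xs)) \<longlongrightarrow> 0) at_top"
    if "L > 0" "L-lipschitz_on UNIV Df" for L
  proof (rule Lim_null_comparison)
    show "((\<lambda>t. sqrt (4 * L * (B t * gap t))) \<longlongrightarrow> 0) at_top"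
      using tendsto_real_sqrt[OF tendsto_mult_right_zero[OF gap_lim, of "4 * L"]] by simp
    show "\<forall>\<^sub>F t in at_top. norm (t powr r * sqrt (\<beta> t) * norm (Df (x t) - Df xs)) \<le> sqrt (4 * L * (B t * gap t))"
      using B_ev \<beta>_ev
    proof eventually_elim
      case (elim t)
      have "(norm (Df (x t) - Df xs))\<^sup>2 \<le> 4 * L * gap t"
        unfolding gap_eq by (rule lipschitz_gradient_bound[OF conv grad that])
      then have "B t * (norm (Df (x t) - Df xs))\<^sup>2 \<le> B t * (4 * L * gap t)"
        using elim by (intro mult_left_mono) auto
      moreover have "B t = (t powr r * sqrt (\<beta> t))\<^sup>2"
        unfolding B_def powr_double using elim by (simp add: power_mult_distrib)
      ultimately have "(t powr r * sqrt (\<beta> t) * norm (Df (x t) - Df xs))\<^sup>2 \<le> 4 * L * (B t * gap t)"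
        by (simp add: power_mult_distrib mult_ac)
      then show ?case using elim by (auto intro: real_le_rsqrt simp: abs_mult)
    qed
  qed
  have dual_lim: "((\<lambda>t. t powr r * sqrt (\<beta> t) * norm (adjoint A (lam t - lams))) \<longlongrightarrow> 0) at_top"
    if L: "L > 0" "L-lipschitz_on UNIV Df" for L
  proof -
    obtain m where "m > 0" and ev: "\<forall>\<^sub>F t in at_top. m \<le> t powr r * sqrt (\<beta> t) \<and> m \<le> t powr (2 * r) * \<beta> t"
      using scale_lower_bound by blast
    show ?thesis
    proof (rule Lim_null_comparison)
      show "((\<lambda>t. norm (B t *\<^sub>R (Df (x t) + adjoint A (lam t))) / m
          + t powr r * sqrt (\<beta> t) * norm (Df (x t) - Df xs)) \<longlongrightarrow> 0) at_top"
        using tendsto_add[OF tendsto_divide[OF tendsto_norm_zero[OF KKT1] tendsto_const[of m]] Df_lim[OF L]]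
          \<open>m > 0\<close> by simp
      show "\<forall>\<^sub>F t in at_top. norm (t powr r * sqrt (\<beta> t) * norm (adjoint A (lam t - lams)))
          \<le> norm (B t *\<^sub>R (Df (x t) + adjoint A (lam t))) / m
            + t powr r * sqrt (\<beta> t) * norm (Df (x t) - Df xs)"
        using B_ev \<beta>_ev ev
      proof eventually_elim
        case (elim t)
        define s where "s = t powr r * sqrt (\<beta> t)"
        have s: "m \<le> s" "0 < s" using elim \<open>m > 0\<close> by (auto simp: s_def)
        have B: "B t = s * s"
          unfolding B_def s_def powr_double using elim by (simp add: power2_eq_square)
        \<comment> \<open>Stationarity at the solution splits the dual error into a
          \<open>KKT\<close> component, known at the stronger weight \<open>s * s\<close>, and the
          gradient error at weight \<open>s\<close>; the bound \<open>m \<le> s\<close> makes the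
          former sufficient.\<close>
        have "adjoint A (lam t - lams) = (Df (x t) + adjoint A (lam t)) - (Df (x t) - Df xs)"
          by (simp add: A'.diff Dxs)
        then have "norm (adjoint A (lam t - lams))
            \<le> norm (Df (x t) + adjoint A (lam t)) + norm (Df (x t) - Df xs)"
          by (metis norm_triangle_ineq4)
        then have "s * norm (adjoint A (lam t - lams))
            \<le> s * norm (Df (x t) + adjoint A (lam t)) + s * norm (Df (x t) - Df xs)"
          using s mult_left_mono[of _ _ s] by (fastforce simp: distrib_left)
        moreover have "m * (s * norm (Df (x t) + adjoint A (lam t))) \<le> s * (s * norm (Df (x t) + adjoint A (lam t)))"
          using s by (intro mult_right_mono) auto
        then have "s * norm (Df (x t) + adjoint A (lam t)) \<le> norm (B t *\<^sub>R (Df (x t) + adjoint A (lam t))) / m"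
          using \<open>m > 0\<close> by (simp add: B pos_le_divide_eq mult_ac)
        moreover have "norm (s * norm (adjoint A (lam t - lams))) = s * norm (adjoint A (lam t - lams))"
          using s by simp
        ultimately show ?case unfolding s_def by linarith
      qed
    qed
  qed
  have sqrt_ev: "\<forall>\<^sub>F t in at_top. 0 < sqrt (\<beta> t)" using \<beta>_ev by eventually_elim simp
  have one_ev: "\<forall>\<^sub>F t :: real in at_top. (0 :: real) < 1" by simp
  have *: "2 * \<rho> \<le> 2 * r" "\<rho> + r \<le> 2 * r" using \<rho> by simp_all
  have "(\<lambda>t. norm (x' t)) \<in> o(\<lambda>t. 1 / (t powr \<rho> * 1))" "(\<lambda>t. norm (lam' t)) \<in> o(\<lambda>t. 1 / (t powr \<rho> * 1))"
    using x'_lim lam'_lim by (intro smallo_inverse_powrI[OF _ \<rho> one_ev]; simp)+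
  then show ?thesis
    unfolding convergence_rates_def
    using smallo_inverse_powrI[OF gap_lim[unfolded B_def gap_def] *(1) \<beta>_ev]
      smallo_inverse_powrI[OF f_lim[unfolded B_def] *(1) \<beta>_ev]
      smallo_inverse_powrI[OF feas_lim[unfolded B_def] *(2) \<beta>_ev]
      smallo_inverse_powrI[OF Df_lim \<rho> sqrt_ev] smallo_inverse_powrI[OF dual_lim \<rho> sqrt_ev]
    by simp blast
qed

end

section \<open>Reduction of the theorem to the locale\<close>

theorem theorem2p2:
  fixes f :: "'a::{real_inner, complete_space} \<Rightarrow> real"
    and Df :: "'a \<Rightarrow> 'a"
    and A :: "'a \<Rightarrow> 'b::{real_inner, complete_space}"
    and b :: 'b
    and t\<^sub>0 r \<alpha> \<theta> :: real
    and \<beta> \<beta>' :: "real \<Rightarrow> real"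
    and x x' x'' G' :: "real \<Rightarrow> 'a"
    and lam lam' lam'' :: "real \<Rightarrow> 'b"
    and xs :: 'a
    and lams :: 'b
  assumes "bounded_linear A"
    and "convex_on UNIV f"
    and "\<And>y. GDERIV f y :> Df y"
    and "continuous_on UNIV Df"
    and "t\<^sub>0 > 0" and "0 \<le> r" and "r \<le> 1" and "\<alpha> > 0" and "\<theta> > 0"
    and "r < 1 \<Longrightarrow> 2 / \<alpha> < \<theta>"
    and "r = 1 \<Longrightarrow> 2 / (\<alpha> + 1) \<le> \<theta> \<and> \<theta> < 1 / 2"
    and "\<And>t. t \<ge> t\<^sub>0 \<Longrightarrow> \<beta> t > 0"
    and "\<And>t. t \<ge> t\<^sub>0 \<Longrightarrow> (\<beta> has_real_derivative \<beta>' t) (at t within {t\<^sub>0..})"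
    and "continuous_on {t\<^sub>0..} \<beta>'"
    and "mono_on {t\<^sub>0..} \<beta>"
    and "(SUP t\<in>{t\<^sub>0..}. ereal (t powr r * (\<beta>' t / \<beta> t + 2 * r / t))) < ereal (1 / \<theta>)"
    and "primal_dual_solution Df A b xs lams"
    and "primal_dual_trajectory Df A b t\<^sub>0 r \<alpha> \<theta> \<beta> x x' x'' G' lam lam' lam''"
  shows
    "(0 < r \<and> r < 1 \<longrightarrow>
        (\<forall>\<rho>. 0 < \<rho> \<and> \<rho> < r \<longrightarrow> convergence_rates f Df A b r \<beta> x x' lam lam' xs lams \<rho>) \<and>
        (bounded ((\<lambda>t. (x t, lam t)) ` {t\<^sub>0..}) \<longrightarrow>
           convergence_rates f Df A b r \<beta> x x' lam lam' xs lams r)) \<and>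
     (r = 0 \<or> r = 1 \<longrightarrow> bounded ((\<lambda>t. (x t, lam t)) ` {t\<^sub>0..})) \<and>
     (r = 0 \<longrightarrow> convergence_rates f Df A b r \<beta> x x' lam lam' xs lams 0) \<and>
     (r = 1 \<longrightarrow> convergence_rates f Df A b r \<beta> x x' lam lam' xs lams 1) \<and>
     (r = 0 \<or> r = 1 \<or> (0 < r \<and> r < 1 \<and> bounded ((\<lambda>t. (x t, lam t)) ` {t\<^sub>0..})) \<longrightarrow>
        (\<exists>xw lamw. primal_dual_solution Df A b xw lamw \<and>
           weakly_tendsto (\<lambda>t. (x t, lam t)) (xw, lamw) at_top))"
proof -
  have damping: "1 / \<theta> + (if r = 1 then 1 else 0) < \<alpha>"
  proof (cases "r = 1")
    case True
    then have "2 / (\<alpha> + 1) \<le> \<theta>" "\<theta> < 1 / 2" using assms(11) by auto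
    \<comment> \<open>Subtracting the second bound from the first gives
      \<open>1 / \<theta> < \<alpha> - 1\<close>, the strict damping condition.\<close>
    then have "2 * (1 / \<theta>) \<le> \<alpha> + 1" "2 < 1 / \<theta>"
      using \<open>\<theta> > 0\<close> \<open>\<alpha> > 0\<close> by (simp_all add: field_simps)
    then have "1 / \<theta> + 1 < \<alpha>" by linarith
    then show ?thesis using True by simp
  next
    case False
    then have "2 / \<alpha> < \<theta>" using assms(7,10) by simp
    then have "2 * (1 / \<theta>) < \<alpha>" "0 < 1 / \<theta>" using \<open>\<theta> > 0\<close> \<open>\<alpha> > 0\<close> by (simp_all add: field_simps)
    then have "1 / \<theta> < \<alpha>" by linarith
    then show ?thesis using False by simp
  qed
  have growth: "\<exists>c<1 / \<theta>. \<forall>t\<ge>t\<^sub>0. t powr r * (\<beta>' t / \<beta> t + 2 * r / t) \<le> c"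
  proof -
    \<comment> \<open>A real number strictly between the extended supremum and
      \<open>1 / \<theta>\<close> serves as a uniform growth bound.\<close>
    obtain c where c: "(SUP t\<in>{t\<^sub>0..}. ereal (t powr r * (\<beta>' t / \<beta> t + 2 * r / t))) < ereal c" "ereal c < ereal (1 / \<theta>)"
      using ereal_dense2[OF assms(16)] by blast
    have "t powr r * (\<beta>' t / \<beta> t + 2 * r / t) \<le> c" if "t \<ge> t\<^sub>0" for t
    proof -
      have "ereal (t powr r * (\<beta>' t / \<beta> t + 2 * r / t))
          \<le> (SUP t\<in>{t\<^sub>0..}. ereal (t powr r * (\<beta>' t / \<beta> t + 2 * r / t)))"
        using that by (intro SUP_upper) simp
      with c(1) have "ereal (t powr r * (\<beta>' t / \<beta> t + 2 * r / t)) < ereal c" by (rule le_less_trans[rotated])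
      then show ?thesis by simp
    qed
    then show ?thesis using c(2) by auto
  qed
  interpret primal_dual_flow f Df A b t\<^sub>0 r \<alpha> \<theta> \<beta> \<beta>' x x' x'' G' lam lam' lam''
    by (rule primal_dual_flow.intro) (fact assms damping growth)+
  have zs: "KKT (xs, lams) = 0" using assms(17) by (simp add: KKT_eq_0_iff)
  obtain w where w: "KKT w = 0" "weakly_tendsto (\<lambda>t. (x t, lam t)) w at_top"
    using weak_convergence[OF zs] by blast
  then have "primal_dual_solution Df A b (fst w) (snd w)"
    "weakly_tendsto (\<lambda>t. (x t, lam t)) (fst w, snd w) at_top"
    using KKT_eq_0_iff[of "fst w" "snd w"] by simp_all
  then have "\<exists>xw lamw. primal_dual_solution Df A b xw lamw \<and>
      weakly_tendsto (\<lambda>t. (x t, lam t)) (xw, lamw) at_top" by blast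
  then show ?thesis by (intro conjI impI allI bounded_orbit[OF zs] rates[OF assms(17)]) simp_all
qed

end
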